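(* Let $E$ be a separable complex Hilbert space, $\sigma>0$ and $\theta\in[0,2\pi)$. Let $\mathcal{M}$ be a nonzero closed subspace of $H^2_E(\mathbb{T})\oplus E$ with $\mathcal{M}\nsubseteq H^2_E(\mathbb{T})\oplus\{0\}$. Then $\mathcal{M}$ is invariant under $B^E_{\sigma,e^{i\theta}}$ if and only if there exist a nonzero Hilbert space $E_2$, an inner function $\Phi\in H^\infty_{\mathcal{B}(E_2,E)}(\mathbb{T})$, and a nonzero subset $\mathcal{G}\subseteq\mathcal{G}_\Phi$ such that \[ \mathcal{M}=\langle\mathcal{G}\rangle\oplus\left(\Phi H^2_{E_2}(\mathbb{T})\oplus\{0\}\right). \]
   Context: $\mathbb{D}=\{z\in\mathbb{C}:|z|<1\}$ and $\mathbb{T}=\partial\mathbb{D}$. For a complex Hilbert space $E$, $H^2_E(\mathbb{T})$ is the $E$-valued Hardy space, i.e. the closed subspace of $L^2_E(\mathbb{T})$ of functions whose Fourier coefficients of negative index vanish (equivalently, square-summable $E$-valued power series on $\mathbb{D}$), and $S_E$ is the shift $S_Ef=zf$ on it. Elements of $E$ are identified with constant functions; $i_E:E\to H^2_E(\mathbb{T})$ is the inclusion $(i_Ex)(z)=x$. The Brownian shift on $H^2_E(\mathbb{T})\oplus E$ of covariance $\sigma>0$ and angle $\theta\in[0,2\pi)$ is the bounded operator \[ B^E_{\sigma,e^{i\theta}}=\begin{bmatrix}S_E&\sigma i_E\\ 0&e^{i\theta}I_E\end{bmatrix},\qquad B^E_{\sigma,e^{i\theta}}\begin{bmatrix}f\\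 x\end{bmatrix}=\begin{bmatrix}zf+\sigma x\\ e^{i\theta}x\end{bmatrix}. \] For Hilbert spaces $E_*,E$, $H^\infty_{\mathcal{B}(E_*,E)}(\mathbb{T})$ is the Banach space of bounded analytic functions on $\mathbb{D}$ with values in $\mathcal{B}(E_*,E)$ (bounded operators from $E_*$ to $E$). Each such $\Phi$ induces the multiplication operator $M_\Phi:H^2_{E_*}(\mathbb{T})\to H^2_E(\mathbb{T})$, $M_\Phi f=\Phi f$; $\Phi$ is called inner if $M_\Phi$ is an isometry (equivalently, $\Phi(z)$ is an isometry for almost every $z\in\mathbb{T}$). $\Phi H^2_{E_*}(\mathbb{T})$ denotes the range of $M_\Phi$. For fixed $\sigma,\theta$ and an inner function $\Phi\in H^\infty_{\mathcal{B}(E_2,E)}(\mathbb{T})$, set \[ \mathcal{G}_\Phi=\left\{\begin{bmatrix}g\\ y\end{bmatrix}\in H^2_E(\mathbb{T})\oplus E:\ y\in E,\ g=\frac{\Phi x-\sigma y}{z-e^{i\theta}}\in H^2_E(\mathbb{T})\text{ for some }x\in E_2\right\}. \] $\langle\mathcal{N}\rangle$ denotes the closed linear span of a set $\mathcal{N}$; a subset is nonzero if it contains a nonzero element; $\oplus$ between subspaces of $H^2_E(\mathbb{T})\oplus E$ denotes an orthogonal direct sum. *)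

theory Defs
  imports "HOL-Analysis.Analysis"
begin

section \<open>Complex Hilbert spaces\<close>

text \<open>
  The library has real inner product spaces only.  A complex one is a real one together with a
  complex scalar multiplication and a sesquilinear form (linear in the first argument) whose real
  part is the real inner product; norm and topology are those of \<^class>\<open>real_inner\<close>.
\<close>

class complex_inner = real_inner +
  fixes scaleC :: "complex \<Rightarrow> 'a \<Rightarrow> 'a" (infixr "*\<^sub>C" 75)
    and cinner :: "'a \<Rightarrow> 'a \<Rightarrow> complex"
  assumes scaleC_add_right: "c *\<^sub>C (x + y) = c *\<^sub>C x + c *\<^sub>C y"
    and scaleC_add_left: "(c + d) *\<^sub>C x = c *\<^sub>C x + d *\<^sub>C x"
    and scaleC_scaleC: "c *\<^sub>C (d *\<^sub>C x) = (c * d) *\<^sub>C x"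
    and scaleR_scaleC: "r *\<^sub>R x = complex_of_real r *\<^sub>C x"
    and cinner_commute: "cinner x y = cnj (cinner y x)"
    and cinner_add_left: "cinner (x + y) z = cinner x z + cinner y z"
    and cinner_scaleC_left: "cinner (c *\<^sub>C x) y = c * cinner x y"
    and Re_cinner: "Re (cinner x y) = inner x y"

class chilbert_space = complex_inner + complete_space

subclass (in chilbert_space) banach ..

lemma scaleC_one: "1 *\<^sub>C (x :: 'a::complex_inner) = x"
  by (metis of_real_1 scaleR_one scaleR_scaleC)

global_interpretation complex_vector:
  vector_space "scaleC :: complex \<Rightarrow> 'a::complex_inner \<Rightarrow> 'a"
  defines csubspace = complex_vector.subspace
    and cspan = complex_vector.span
  by unfold_locales (simp_all add: scaleC_add_right scaleC_add_left scaleC_scaleC scaleC_one)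

lemma cinner_self: "cinner x x = complex_of_real ((norm (x :: 'a::complex_inner))\<^sup>2)"
proof -
  have "Im (cinner x x) = 0"
    using cinner_commute[of x x] by (metis Im_complex_of_real complex_In_mult_cnj_zero
        add_0_iff cnj.simps(2) eq_neg_iff_add_eq_0 mult_2 mult_eq_0_iff zero_neq_numeral)
  then show ?thesis
    by (simp add: complex_eq_iff Re_cinner power2_norm_eq_inner)
qed

lemma cinner_scaleC_right: "cinner (x :: 'a::complex_inner) (c *\<^sub>C y) = cnj c * cinner x y"
  by (metis cinner_commute cinner_scaleC_left complex_cnj_mult)

lemma norm_scaleC: "norm (c *\<^sub>C (x :: 'a::complex_inner)) = cmod c * norm x"
proof -
  have "complex_of_real ((norm (c *\<^sub>C x))\<^sup>2) = complex_of_real ((cmod c * norm x)\<^sup>2)"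
    unfolding cinner_self[symmetric] cinner_scaleC_left cinner_scaleC_right
    using complex_norm_square[of c] by (simp add: cinner_self power_mult_distrib)
  then show ?thesis
    by (metis norm_ge_zero of_real_eq_iff power2_eq_imp_eq zero_le_mult_iff)
qed

lemma scaleC_scaleR_commute: "c *\<^sub>C (r *\<^sub>R (x :: 'a::complex_inner)) = r *\<^sub>R (c *\<^sub>C x)"
  by (simp add: scaleR_scaleC mult.commute)

lemma cmod_cinner_le: "cmod (cinner x y) \<le> norm (x :: 'a::complex_inner) * norm y"
proof (cases "cinner x y = 0")
  case False
  define u where "u = cnj (sgn (cinner x y))"
  have "cinner (u *\<^sub>C x) y = complex_of_real (cmod (cinner x y))"
    using False complex_norm_square[of "cinner x y"]
    by (simp add: u_def cinner_scaleC_left sgn_div_norm scaleR_conv_of_real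
        power2_eq_square field_simps)
  then have "cmod (cinner x y) = inner (u *\<^sub>C x) y"
    by (metis Re_cinner Re_complex_of_real)
  also have "\<dots> \<le> norm (u *\<^sub>C x) * norm y"
    by (rule norm_cauchy_schwarz)
  also have "\<dots> = norm x * norm y"
    using False by (simp add: norm_scaleC u_def norm_sgn)
  finally show ?thesis .
qed simp

lemma bounded_linear_scaleC: "bounded_linear (\<lambda>x :: 'a::complex_inner. c *\<^sub>C x)"
  by (rule bounded_linear_intro[where K = "cmod c"])
    (simp_all add: scaleC_add_right scaleC_scaleR_commute norm_scaleC mult.commute)

instantiation complex :: chilbert_space
begin
definition "scaleC_complex = ((*) :: complex \<Rightarrow> complex \<Rightarrow> complex)"
definition "cinner_complex x y = x * cnj y" for x y :: complex
instance
  by standard (auto simp: scaleC_complex_def cinner_complex_def algebra_simps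
      scaleR_conv_of_real inner_complex_def)
end

instantiation prod :: (complex_inner, complex_inner) complex_inner
begin
definition "scaleC_prod c x = (c *\<^sub>C fst x, c *\<^sub>C snd x)" for x :: "'a \<times> 'b"
definition "cinner_prod x y = cinner (fst x) (fst y) + cinner (snd x) (snd y)" for x y :: "'a \<times> 'b"
instance
proof
  fix x y z :: "'a \<times> 'b" and c d :: complex and r :: real
  show "cinner x y = cnj (cinner y x)"
    by (simp add: cinner_prod_def cinner_commute[of "fst x"] cinner_commute[of "snd x"])
qed (auto simp: scaleC_prod_def cinner_prod_def scaleC_add_right scaleC_add_left scaleC_scaleC
      scaleR_scaleC cinner_add_left cinner_scaleC_left Re_cinner inner_prod_def algebra_simps
      scaleR_prod_def)
end

instance prod :: (chilbert_space, chilbert_space) chilbert_space ..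

definition orthogonal_direct_sum :: "'a::complex_inner set \<Rightarrow> 'a set \<Rightarrow> 'a set \<Rightarrow> bool" where
  "orthogonal_direct_sum M A B \<longleftrightarrow>
     (\<forall>a\<in>A. \<forall>b\<in>B. cinner a b = 0) \<and> M = {a + b | a b. a \<in> A \<and> b \<in> B}"


section \<open>The vector-valued Hardy space\<close>

text \<open>
  An element of the Hardy space is a square-summable power series with vector coefficients, stored
  as its coefficient sequence; \<open>hardy_eval\<close> is the analytic function it defines on the open unit
  disc.
\<close>

typedef (overloaded) 'a hardy = "{a :: nat \<Rightarrow> 'a::complex_inner. summable (\<lambda>n. (norm (a n))\<^sup>2)}"
  morphisms hcoeff Abs_hardy
  by (rule exI[of _ "\<lambda>_. 0"]) simp

setup_lifting type_definition_hardy

lemma summable_hcoeff: "summable (\<lambda>n. (norm (hcoeff f n))\<^sup>2)"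
  using hcoeff[of f] by simp

lemma hardy_eqI: "(\<And>n. hcoeff f n = hcoeff g n) \<Longrightarrow> f = g"
  by (metis ext hcoeff_inject)

lemma square_summable_add:
  fixes a b :: "nat \<Rightarrow> 'a::real_inner"
  assumes "summable (\<lambda>n. (norm (a n))\<^sup>2)" "summable (\<lambda>n. (norm (b n))\<^sup>2)"
  shows "summable (\<lambda>n. (norm (a n + b n))\<^sup>2)"
proof (rule summable_comparison_test')
  show "summable (\<lambda>n. 2 * (norm (a n))\<^sup>2 + 2 * (norm (b n))\<^sup>2)"
    by (intro summable_add summable_mult assms)
  fix n
  have "0 \<le> (norm (a n - b n))\<^sup>2" by simp
  then have "(norm (a n + b n))\<^sup>2 \<le> 2 * (norm (a n))\<^sup>2 + 2 * (norm (b n))\<^sup>2"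
    by (simp add: power2_norm_eq_inner inner_simps inner_commute)
  then show "norm ((norm (a n + b n))\<^sup>2) \<le> 2 * (norm (a n))\<^sup>2 + 2 * (norm (b n))\<^sup>2"
    by simp
qed

lemma square_summable_mult:
  fixes a b :: "nat \<Rightarrow> 'a::real_inner" and g :: "nat \<Rightarrow> 'b::banach"
  assumes "summable (\<lambda>n. (norm (a n))\<^sup>2)" "summable (\<lambda>n. (norm (b n))\<^sup>2)"
    and "\<And>n. norm (g n) \<le> norm (a n) * norm (b n)"
  shows "summable g"
proof (rule summable_comparison_test')
  show "summable (\<lambda>n. (norm (a n))\<^sup>2 + (norm (b n))\<^sup>2)"
    by (intro summable_add assms)
  fix n
  have "norm (a n) * norm (b n) \<le> (norm (a n))\<^sup>2 + (norm (b n))\<^sup>2"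
    using sum_squares_bound[of "norm (a n)" "norm (b n)"]
      mult_nonneg_nonneg[OF norm_ge_zero[of "a n"] norm_ge_zero[of "b n"]] by linarith
  then show "norm (g n) \<le> (norm (a n))\<^sup>2 + (norm (b n))\<^sup>2"
    using assms(3)[of n] by linarith
qed

lemma summable_inner_hcoeff: "summable (\<lambda>n. inner (hcoeff f n) (hcoeff g n))"
  by (rule square_summable_mult[OF summable_hcoeff[of f] summable_hcoeff[of g]])
    (simp add: Cauchy_Schwarz_ineq2)

lemma summable_cinner_hcoeff: "summable (\<lambda>n. cinner (hcoeff f n) (hcoeff g n))"
  by (rule square_summable_mult[OF summable_hcoeff summable_hcoeff]) (rule cmod_cinner_le)

instantiation hardy :: (complex_inner) complex_inner
begin

lift_definition zero_hardy :: "'a hardy" is "\<lambda>_. 0" by simp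
lift_definition plus_hardy :: "'a hardy \<Rightarrow> 'a hardy \<Rightarrow> 'a hardy" is "\<lambda>a b n. a n + b n"
  by (rule square_summable_add)
lift_definition uminus_hardy :: "'a hardy \<Rightarrow> 'a hardy" is "\<lambda>a n. - a n" by simp
lift_definition minus_hardy :: "'a hardy \<Rightarrow> 'a hardy \<Rightarrow> 'a hardy" is "\<lambda>a b n. a n - b n"
  subgoal for a b using square_summable_add[of a "\<lambda>n. - b n"] by simp
  done
lift_definition scaleC_hardy :: "complex \<Rightarrow> 'a hardy \<Rightarrow> 'a hardy" is "\<lambda>c a n. c *\<^sub>C a n"
  by (simp add: norm_scaleC power_mult_distrib summable_mult)
definition scaleR_hardy :: "real \<Rightarrow> 'a hardy \<Rightarrow> 'a hardy"
  where "scaleR_hardy r f = complex_of_real r *\<^sub>C f"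
definition inner_hardy :: "'a hardy \<Rightarrow> 'a hardy \<Rightarrow> real"
  where "inner_hardy f g = (\<Sum>n. inner (hcoeff f n) (hcoeff g n))"
definition cinner_hardy :: "'a hardy \<Rightarrow> 'a hardy \<Rightarrow> complex"
  where "cinner_hardy f g = (\<Sum>n. cinner (hcoeff f n) (hcoeff g n))"
definition norm_hardy :: "'a hardy \<Rightarrow> real"
  where "norm_hardy f = sqrt (inner f f)"
definition dist_hardy :: "'a hardy \<Rightarrow> 'a hardy \<Rightarrow> real"
  where "dist_hardy f g = norm (f - g)"
definition sgn_hardy :: "'a hardy \<Rightarrow> 'a hardy"
  where "sgn_hardy f = inverse (norm f) *\<^sub>R f"
definition uniformity_hardy :: "('a hardy \<times> 'a hardy) filter"
  where "uniformity_hardy = (INF e\<in>{0<..}. principal {(f, g). dist f g < e})"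
definition open_hardy :: "'a hardy set \<Rightarrow> bool"
  where "open_hardy U \<longleftrightarrow> (\<forall>f\<in>U. eventually (\<lambda>(f', g). f' = f \<longrightarrow> g \<in> U) uniformity)"

lemma hcoeff_scaleR: "hcoeff (r *\<^sub>R f) n = r *\<^sub>R hcoeff f n" for f :: "'a hardy"
  by (simp add: scaleR_hardy_def scaleC_hardy.rep_eq scaleR_scaleC)

instance
proof
  fix f g h :: "'a hardy" and r s :: real and c d :: complex and U :: "'a hardy set"
  note rep = zero_hardy.rep_eq plus_hardy.rep_eq uminus_hardy.rep_eq minus_hardy.rep_eq
    scaleC_hardy.rep_eq hcoeff_scaleR
  show "f + g + h = f + (g + h)" "f + g = g + f" "0 + f = f" "- f + f = 0" "f - g = f + - g"
    by (auto intro!: hardy_eqI simp: rep)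
  show "r *\<^sub>R (f + g) = r *\<^sub>R f + r *\<^sub>R g" "(r + s) *\<^sub>R f = r *\<^sub>R f + s *\<^sub>R f"
    "r *\<^sub>R s *\<^sub>R f = (r * s) *\<^sub>R f" "1 *\<^sub>R f = f"
    by (auto intro!: hardy_eqI simp: rep algebra_simps)
  show "c *\<^sub>C (f + g) = c *\<^sub>C f + c *\<^sub>C g" "(c + d) *\<^sub>C f = c *\<^sub>C f + d *\<^sub>C f"
    "c *\<^sub>C d *\<^sub>C f = (c * d) *\<^sub>C f" "r *\<^sub>R f = complex_of_real r *\<^sub>C f"
    by (auto intro!: hardy_eqI simp: rep scaleC_add_right scaleC_add_left scaleC_scaleC scaleR_scaleC)
  show "sgn f = inverse (norm f) *\<^sub>R f" "dist f g = norm (f - g)" "norm f = sqrt (inner f f)"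
    by (simp_all add: sgn_hardy_def dist_hardy_def norm_hardy_def)
  show "uniformity = (INF e\<in>{0<..}. principal {(f :: 'a hardy, g). dist f g < e})"
    by (rule uniformity_hardy_def)
  show "open U \<longleftrightarrow> (\<forall>f\<in>U. eventually (\<lambda>(f', g). f' = f \<longrightarrow> g \<in> U) uniformity)"
    by (rule open_hardy_def)
  show "inner f g = inner g f"
    by (simp add: inner_hardy_def inner_commute)
  show "inner (f + g) h = inner f h + inner g h"
    by (simp add: inner_hardy_def rep inner_add_left suminf_add summable_inner_hcoeff)
  show "inner (r *\<^sub>R f) g = r * inner f g"
    by (simp add: inner_hardy_def rep suminf_mult summable_inner_hcoeff)
  show "0 \<le> inner f f"
    by (simp add: inner_hardy_def suminf_nonneg summable_inner_hcoeff)
  show "inner f f = 0 \<longleftrightarrow> f = 0"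
    using suminf_eq_zero_iff[OF summable_inner_hcoeff, of f f]
    by (auto simp: inner_hardy_def rep intro: hardy_eqI)
  show "cinner f g = cnj (cinner g f)"
    using bounded_linear.suminf[OF bounded_linear_cnj summable_cinner_hcoeff, of g f]
    by (simp add: cinner_hardy_def cinner_commute[of "hcoeff f _"])
  show "cinner (f + g) h = cinner f h + cinner g h"
    by (simp add: cinner_hardy_def rep cinner_add_left suminf_add summable_cinner_hcoeff)
  show "cinner (c *\<^sub>C f) g = c * cinner f g"
    by (simp add: cinner_hardy_def rep cinner_scaleC_left suminf_mult summable_cinner_hcoeff)
  show "Re (cinner f g) = inner f g"
    using bounded_linear.suminf[OF bounded_linear_Re summable_cinner_hcoeff, of f g]
    by (simp add: cinner_hardy_def inner_hardy_def Re_cinner)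
qed

end

lemma norm_hardy_square: "(norm f)\<^sup>2 = (\<Sum>n. (norm (hcoeff f n))\<^sup>2)"
  by (simp add: power2_norm_eq_inner inner_hardy_def)

lemma sum_hcoeff_le: "(\<Sum>n\<in>A. (norm (hcoeff f n))\<^sup>2) \<le> (norm f)\<^sup>2" if "finite A"
  unfolding norm_hardy_square using that by (intro sum_le_suminf summable_hcoeff) auto

lemma norm_hcoeff_le: "norm (hcoeff f n) \<le> norm f"
  using sum_hcoeff_le[of "{n}" f] by (simp add: power2_le_iff_abs_le)

instance hardy :: (chilbert_space) chilbert_space
proof
  fix X :: "nat \<Rightarrow> 'a hardy"
  assume X: "Cauchy X"
  have "Cauchy (\<lambda>m. hcoeff (X m) n)" for n
  proof (rule CauchyI)
    fix e :: real assume "0 < e"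
    then obtain N where N: "\<And>m k. m \<ge> N \<Longrightarrow> k \<ge> N \<Longrightarrow> norm (X m - X k) < e"
      using CauchyD[OF X] by blast
    have "norm (hcoeff (X m) n - hcoeff (X k) n) < e" if "m \<ge> N" "k \<ge> N" for m k
      using norm_hcoeff_le[of "X m - X k" n] N[OF that] by (simp add: minus_hardy.rep_eq)
    then show "\<exists>N. \<forall>m\<ge>N. \<forall>k\<ge>N. norm (hcoeff (X m) n - hcoeff (X k) n) < e" by blast
  qed
  then have "\<forall>n. \<exists>l. (\<lambda>m. hcoeff (X m) n) \<longlonglongrightarrow> l"
    by (simp add: Cauchy_convergent_iff convergent_def)
  then obtain L where L: "\<And>n. (\<lambda>m. hcoeff (X m) n) \<longlonglongrightarrow> L n" by metis
  have bound: "\<exists>N. \<forall>m\<ge>N. summable (\<lambda>n. (norm (hcoeff (X m) n - L n))\<^sup>2) \<and>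
      (\<Sum>n. (norm (hcoeff (X m) n - L n))\<^sup>2) \<le> e\<^sup>2" if "0 < e" for e
  proof -
    obtain N where N: "\<And>m k. m \<ge> N \<Longrightarrow> k \<ge> N \<Longrightarrow> norm (X m - X k) < e"
      using CauchyD[OF X \<open>0 < e\<close>] by blast
    have "summable (\<lambda>n. (norm (hcoeff (X m) n - L n))\<^sup>2) \<and>
      (\<Sum>n. (norm (hcoeff (X m) n - L n))\<^sup>2) \<le> e\<^sup>2" if m: "m \<ge> N" for m
    proof -
      have le: "(\<Sum>n<K. (norm (hcoeff (X m) n - L n))\<^sup>2) \<le> e\<^sup>2" for K
      proof (rule LIMSEQ_le_const2)
        show "(\<lambda>k. \<Sum>n<K. (norm (hcoeff (X m) n - hcoeff (X k) n))\<^sup>2)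
            \<longlonglongrightarrow> (\<Sum>n<K. (norm (hcoeff (X m) n - L n))\<^sup>2)"
          by (intro tendsto_intros L)
        have "(\<Sum>n<K. (norm (hcoeff (X m) n - hcoeff (X k) n))\<^sup>2) \<le> e\<^sup>2" if "k \<ge> N" for k
        proof -
          have "(norm (X m - X k))\<^sup>2 \<le> e\<^sup>2"
            using N[OF m that] by (intro power_mono) auto
          with sum_hcoeff_le[of "{..<K}" "X m - X k"] show ?thesis
            by (simp add: minus_hardy.rep_eq)
        qed
        then show "\<exists>N. \<forall>k\<ge>N. (\<Sum>n<K. (norm (hcoeff (X m) n - hcoeff (X k) n))\<^sup>2) \<le> e\<^sup>2" by blast
      qed
      have "summable (\<lambda>n. (norm (hcoeff (X m) n - L n))\<^sup>2)"
        by (rule summableI_nonneg_bounded[OF _ le]) simp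
      with suminf_le_const[OF this le] show ?thesis by blast
    qed
    then show ?thesis by blast
  qed
  obtain M where "summable (\<lambda>n. (norm (hcoeff (X M) n - L n))\<^sup>2)"
    using bound[of 1] by auto
  from square_summable_add[OF this summable_hcoeff[of "- X M"]]
  have "summable (\<lambda>n. (norm (L n))\<^sup>2)"
    by (simp add: uminus_hardy.rep_eq)
  then obtain f where f: "hcoeff f = L"
    using Abs_hardy_inverse[of L] by auto
  have "X \<longlonglongrightarrow> f"
  proof (rule LIMSEQ_I)
    fix e :: real assume "0 < e"
    then obtain N where N: "\<And>m. m \<ge> N \<Longrightarrow> (\<Sum>n. (norm (hcoeff (X m) n - L n))\<^sup>2) \<le> (e / 2)\<^sup>2"
      using bound[of "e / 2"] by auto
    have "norm (X m - f) < e" if "m \<ge> N" for m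
    proof -
      have "(norm (X m - f))\<^sup>2 \<le> (e / 2)\<^sup>2"
        using N[OF that] by (simp add: norm_hardy_square minus_hardy.rep_eq f)
      then have "norm (X m - f) \<le> e / 2"
        using \<open>0 < e\<close> by (meson half_gt_zero less_imp_le power2_le_imp_le)
      with \<open>0 < e\<close> show ?thesis by linarith
    qed
    then show "\<exists>N. \<forall>m\<ge>N. norm (X m - f) < e" by blast
  qed
  then show "convergent X" by (rule convergentI)
qed

definition hardy_eval :: "'a::chilbert_space hardy \<Rightarrow> complex \<Rightarrow> 'a" where
  "hardy_eval f z = (\<Sum>n. (z ^ n) *\<^sub>C hcoeff f n)"

lift_definition hardy_const :: "'a::complex_inner \<Rightarrow> 'a hardy" is
  "\<lambda>x n. if n = 0 then x else 0"
  by (rule summable_finite[of "{0}"]) auto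

lift_definition hardy_shift :: "'a::complex_inner hardy \<Rightarrow> 'a hardy" is
  "\<lambda>a n. case n of 0 \<Rightarrow> 0 | Suc k \<Rightarrow> a k"
  by (subst summable_Suc_iff[symmetric]) simp

lemma summable_hardy_eval:
  assumes "cmod z < 1"
  shows "summable (\<lambda>n. (z ^ n) *\<^sub>C hcoeff (f :: 'a::chilbert_space hardy) n)"
proof (rule summable_comparison_test')
  show "summable (\<lambda>n. norm f * cmod z ^ n)"
    using assms by (intro summable_mult summable_geometric) simp
  show "norm ((z ^ n) *\<^sub>C hcoeff f n) \<le> norm f * cmod z ^ n" for n
    using mult_right_mono[OF norm_hcoeff_le[of f n], of "cmod z ^ n"]
    by (simp add: norm_scaleC norm_power mult.commute)
qed

lemma hardy_eval_const: "hardy_eval (hardy_const x) z = x"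
proof -
  have "(\<Sum>n. (z ^ n) *\<^sub>C hcoeff (hardy_const x) n) =
      (\<Sum>n\<in>{0}. (z ^ n) *\<^sub>C hcoeff (hardy_const x) n)"
    by (rule suminf_finite) (auto simp: hardy_const.rep_eq)
  then show ?thesis
    by (simp add: hardy_eval_def hardy_const.rep_eq scaleC_one)
qed

lemma hardy_eval_shift:
  assumes "cmod z < 1"
  shows "hardy_eval (hardy_shift f) z = z *\<^sub>C hardy_eval f z"
proof -
  have "hardy_eval (hardy_shift f) z = (\<Sum>n. (z ^ Suc n) *\<^sub>C hcoeff (hardy_shift f) (Suc n))"
    using suminf_split_head[OF summable_hardy_eval[OF assms, of "hardy_shift f"]]
    by (simp add: hardy_eval_def hardy_shift.rep_eq)
  also have "\<dots> = (\<Sum>n. z *\<^sub>C ((z ^ n) *\<^sub>C hcoeff f n))"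
    by (simp add: hardy_shift.rep_eq scaleC_scaleC)
  also have "\<dots> = z *\<^sub>C hardy_eval f z"
    unfolding hardy_eval_def
    by (rule bounded_linear.suminf[OF bounded_linear_scaleC summable_hardy_eval[OF assms], symmetric])
  finally show ?thesis .
qed

definition brownian_shift ::
  "real \<Rightarrow> real \<Rightarrow> 'a::chilbert_space hardy \<times> 'a \<Rightarrow> 'a hardy \<times> 'a" where
  "brownian_shift \<sigma> \<theta> = (\<lambda>(f, x). (hardy_shift f + \<sigma> *\<^sub>R hardy_const x, cis \<theta> *\<^sub>C x))"


section \<open>Bounded analytic and inner operator-valued functions\<close>

text \<open>
  The auxiliary Hilbert space has to be quantified inside formulas, so it is given as a closed
  subspace \<open>S\<close> of some type of class \<^class>\<open>chilbert_space\<close> (the whole type being allowed).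
  Operators defined on \<open>S\<close> are functions on the ambient type of which only the values on \<open>S\<close>
  matter.
  If \<open>\<Phi>\<close> is an inner function from \<open>S\<close> to \<open>'a\<close>, then \<open>x \<mapsto> \<Phi> x\<close> embeds \<open>S\<close> isometrically as a closed
  subspace of \<open>'a hardy\<close>; hence \<open>'a hardy\<close> is a large enough ambient type when the existence of
  such an \<open>S\<close> is asserted.
\<close>

definition hilbert_subspace :: "'b::chilbert_space set \<Rightarrow> bool" where
  "hilbert_subspace S \<longleftrightarrow> csubspace S \<and> closed S"

definition bounded_operator_on :: "'b::chilbert_space set \<Rightarrow> ('b \<Rightarrow> 'a::chilbert_space) \<Rightarrow> bool" where
  "bounded_operator_on S T \<longleftrightarrow>
     (\<forall>x\<in>S. \<forall>y\<in>S. T (x + y) = T x + T y) \<and>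
     (\<forall>c. \<forall>x\<in>S. T (c *\<^sub>C x) = c *\<^sub>C T x) \<and>
     (\<exists>K. \<forall>x\<in>S. norm (T x) \<le> K * norm x)"

text \<open>Analyticity means complex differentiability on the disc with respect to the operator norm.\<close>

definition H_infinity ::
  "'b::chilbert_space set \<Rightarrow> (complex \<Rightarrow> 'b \<Rightarrow> 'a::chilbert_space) set" where
  "H_infinity S = {\<Phi>.
     (\<forall>z\<in>ball 0 1. bounded_operator_on S (\<Phi> z)) \<and>
     (\<exists>K. \<forall>z\<in>ball 0 1. \<forall>x\<in>S. norm (\<Phi> z x) \<le> K * norm x) \<and>
     (\<forall>z\<in>ball 0 1. \<exists>D. bounded_operator_on S D \<and>
        (\<forall>e>0. \<forall>\<^sub>F w in at z. \<forall>x\<in>S.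
           norm (inverse (w - z) *\<^sub>C (\<Phi> w x - \<Phi> z x) - D x) \<le> e * norm x))}"

definition hardy_on :: "'b::chilbert_space set \<Rightarrow> 'b hardy set" where
  "hardy_on S = {f. \<forall>n. hcoeff f n \<in> S}"

text \<open>\<open>is_product \<Phi> f h\<close> says that \<open>h\<close> is the element \<open>\<Phi> f\<close> of the Hardy space.  Since
  multiplication is linear, it is an isometry iff it preserves norms.\<close>

definition is_product ::
  "(complex \<Rightarrow> 'b::chilbert_space \<Rightarrow> 'a::chilbert_space) \<Rightarrow> 'b hardy \<Rightarrow> 'a hardy \<Rightarrow> bool" where
  "is_product \<Phi> f h \<longleftrightarrow> (\<forall>z\<in>ball 0 1. hardy_eval h z = \<Phi> z (hardy_eval f z))"

definition inner_function ::
  "'b::chilbert_space set \<Rightarrow> (complex \<Rightarrow> 'b \<Rightarrow> 'a::chilbert_space) \<Rightarrow> bool" where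
  "inner_function S \<Phi> \<longleftrightarrow> \<Phi> \<in> H_infinity S \<and>
     (\<forall>f\<in>hardy_on S. \<exists>h. is_product \<Phi> f h \<and> norm h = norm f)"

definition mult_range ::
  "'b::chilbert_space set \<Rightarrow> (complex \<Rightarrow> 'b \<Rightarrow> 'a::chilbert_space) \<Rightarrow> 'a hardy set" where
  "mult_range S \<Phi> = {h. \<exists>f\<in>hardy_on S. is_product \<Phi> f h}"

definition G_set ::
  "real \<Rightarrow> real \<Rightarrow> 'b::chilbert_space set \<Rightarrow> (complex \<Rightarrow> 'b \<Rightarrow> 'a::chilbert_space) \<Rightarrow>
     ('a hardy \<times> 'a) set" where
  "G_set \<sigma> \<theta> S \<Phi> = {(g, y). \<exists>x\<in>S. \<forall>z\<in>ball 0 1.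
     hardy_eval g z = inverse (z - cis \<theta>) *\<^sub>C (\<Phi> z x - \<sigma> *\<^sub>R y)}"

definition has_representation ::
  "real \<Rightarrow> real \<Rightarrow> ('a::chilbert_space hardy \<times> 'a) set \<Rightarrow>
     'b::chilbert_space set \<Rightarrow> (complex \<Rightarrow> 'b \<Rightarrow> 'a) \<Rightarrow> ('a hardy \<times> 'a) set \<Rightarrow> bool" where
  "has_representation \<sigma> \<theta> M S \<Phi> G \<longleftrightarrow>
     hilbert_subspace S \<and> S \<noteq> {0} \<and> inner_function S \<Phi> \<and>
     G \<subseteq> G_set \<sigma> \<theta> S \<Phi> \<and> (\<exists>u\<in>G. u \<noteq> 0) \<and>
     orthogonal_direct_sum M (closure (cspan G)) (mult_range S \<Phi> \<times> {0})"

end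

theory Submission
  imports Defs
begin

text \<open>
  Suppose that \<open>M\<close> is invariant under the Brownian shift \<open>B\<close>, and let \<open>N\<close> consist of the \<open>f\<close> with
  \<open>(f, 0) \<in> M\<close>. This is a closed shift-invariant subspace of the Hardy space, so by the theorem of
  Beurling and Lax it is \<open>\<Phi> H\<^sup>2\<close> for an inner function \<open>\<Phi>\<close>. The coefficient space of \<open>\<Phi>\<close> can be taken
  to be the wandering subspace \<open>W = N \<ominus> z N\<close>, whose elements are themselves Hardy functions, and then
  \<open>\<Phi> z a = a(z)\<close>: multiplication by \<open>\<Phi>\<close> sends \<open>(a\<^sub>0, a\<^sub>1, \<dots>)\<close> to \<open>\<Sum>\<^sub>k z\<^sup>k a\<^sub>k\<close>. It is isometric because the
  spaces \<open>z\<^sup>k W\<close> are pairwise orthogonal, and onto \<open>N\<close> because \<open>N = W \<oplus> z N\<close> can be iterated; the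
  remainders \<open>z\<^sup>k r\<^sub>k\<close> do not affect the coefficients of order less than \<open>k\<close>
  (theorem \<open>mult_range_wandering\<close>).

  The remaining part of \<open>M\<close> is \<open>G = M \<ominus> (N \<oplus> 0)\<close>. For \<open>(g, y) \<in> G\<close> the second component of
  \<open>(B - e\<^sup>i\<^sup>\<theta>) (g, y)\<close> vanishes, so its first component \<open>x = z g + \<sigma> y - e\<^sup>i\<^sup>\<theta> g\<close> belongs to \<open>N\<close>, and a
  computation of inner products shows that \<open>x \<bottom> z N\<close>. Hence \<open>x \<in> W\<close>, and solving for \<open>g\<close> gives
  \<open>g = (\<Phi> x - \<sigma> y) / (z - e\<^sup>i\<^sup>\<theta>)\<close>. The space \<open>W\<close> is nonzero since otherwise \<open>(g, y)\<close> would be an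
  eigenvector of \<open>B\<close> for \<open>e\<^sup>i\<^sup>\<theta>\<close>, and there are none.

  Conversely, the formula for \<open>g\<close> says that \<open>B (g, y) = e\<^sup>i\<^sup>\<theta> (g, y) + (\<Phi> x, 0)\<close>, so \<open>B\<close> maps \<open>\<G>\<close>
  into \<open>M\<close>; it maps \<open>\<Phi> H\<^sup>2 \<oplus> 0\<close> into itself, and linearity and continuity do the rest.
\<close>

section \<open>Orthogonal complements in complex Hilbert spaces\<close>

lemma bounded_linear_scaleC_left: "bounded_linear (\<lambda>c. c *\<^sub>C (x :: 'a::complex_inner))"
  by (rule bounded_linear_intro[where K = "norm x"])
    (simp_all add: scaleC_add_left scaleR_scaleC scaleC_scaleC scaleC_complex_def norm_scaleC)

lemma bounded_linear_cinner_left: "bounded_linear (\<lambda>x :: 'a::complex_inner. cinner x y)"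
  by (rule bounded_linear_intro[where K = "norm y"])
    (simp_all add: cinner_add_left scaleR_scaleC cinner_scaleC_left scaleC_complex_def
      cmod_cinner_le)

lemma cinner_zero_left: "cinner 0 (y :: 'a::complex_inner) = 0"
  by (rule linear_0[OF bounded_linear.linear[OF bounded_linear_cinner_left]])

lemma csubspace_imp_subspace:
  assumes "csubspace (V :: 'a::complex_inner set)"
  shows "subspace V"
  using assms by (simp add: real_vector.subspace_def complex_vector.subspace_def scaleR_scaleC)

text \<open>
  The vector of \<open>V\<close> closest to \<open>x\<close> exists because, by the parallelogram law, the sets of almost
  closest vectors have diameters tending to zero.
\<close>
lemma closest_vector_exists:
  fixes V :: "'a::chilbert_space set"
  assumes V: "subspace V" "closed V"
  shows "\<exists>v\<in>V. \<forall>w\<in>V. norm (x - v) \<le> norm (x - w)"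
proof -
  define d where "d = infdist x V"
  have ne: "V \<noteq> {}" using V(1) subspace_0 by blast
  have d0: "d \<ge> 0" by (simp add: d_def infdist_nonneg)
  have dle: "d \<le> norm (x - w)" if "w \<in> V" for w
    using infdist_le[OF that, of x] by (simp add: d_def dist_norm)
  \<comment> \<open>Radii slightly above \<open>d\<close>, chosen so that the parallelogram law bounds the squared diameter of
    \<open>V \<inter> cball x (r n)\<close> by \<open>4 / (n + 1)\<close>.\<close>
  define r where "r n = sqrt (d\<^sup>2 + 1 / real (Suc n))" for n
  define A where "A n = V \<inter> cball x (r n)" for n
  have r2: "(r n)\<^sup>2 = d\<^sup>2 + 1 / real (Suc n)" and r0: "r n \<ge> 0" for n
    using d0 by (auto simp: r_def)
  have rd: "d < r n" for n
    unfolding r_def by (rule real_less_rsqrt) simp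
  have "\<exists>a. \<forall>n. a \<in> A n"
  proof (rule decreasing_closed_nest)
    show "closed (A n)" for n using V(2) by (auto simp: A_def)
    show "A n \<noteq> {}" for n
    proof -
      have "\<exists>w\<in>V. dist x w < r n"
        using rd[of n] ne cInf_lessD[of "dist x ` V" "r n"] by (auto simp: d_def infdist_notempty)
      then show ?thesis by (force simp: A_def)
    qed
    show "A n \<subseteq> A m" if "m \<le> n" for m n
    proof -
      have "r n \<le> r m" using that by (simp add: r_def frac_le)
      then show ?thesis by (auto simp: A_def)
    qed
    fix e :: real assume "e > 0"
    then obtain n where n: "4 / e\<^sup>2 < real (Suc n)"
      using reals_Archimedean2 less_trans by (metis lessI of_nat_less_iff)
    have "dist a b < e" if "a \<in> A n" "b \<in> A n" for a b
    proof -
      have ab: "a \<in> V" "b \<in> V" "norm (x - a) \<le> r n" "norm (x - b) \<le> r n"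
        using that by (auto simp: A_def dist_norm)
      have sq: "(norm (x - a))\<^sup>2 \<le> (r n)\<^sup>2" "(norm (x - b))\<^sup>2 \<le> (r n)\<^sup>2"
        using ab by (auto intro: power_mono)
      have "(1/2) *\<^sub>R (a + b) \<in> V"
        using ab V(1) by (simp add: subspace_add subspace_scale)
      then have "d\<^sup>2 \<le> (norm (x - (1/2) *\<^sub>R (a + b)))\<^sup>2"
        using d0 dle by (intro power_mono) auto
      moreover have "(norm (a - b))\<^sup>2 = 2 * (norm (x - a))\<^sup>2 + 2 * (norm (x - b))\<^sup>2
          - 4 * (norm (x - (1/2) *\<^sub>R (a + b)))\<^sup>2"
        by (simp add: power2_norm_eq_inner inner_simps inner_commute algebra_simps)
      ultimately have "(norm (a - b))\<^sup>2 \<le> 4 * (1 / real (Suc n))"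
        using sq unfolding r2 by linarith
      also have "\<dots> < e\<^sup>2"
        using n \<open>e > 0\<close> by (simp add: field_simps)
      finally show ?thesis
        using \<open>e > 0\<close> by (simp add: dist_norm power2_less_imp_less)
    qed
    then show "\<exists>n. \<forall>a\<in>A n. \<forall>b\<in>A n. dist a b < e" by blast
  qed blast
  then obtain v where v: "\<And>n. v \<in> A n" by blast
  have "(\<lambda>n. r n) \<longlonglongrightarrow> sqrt (d\<^sup>2 + 0)"
    unfolding r_def by (intro tendsto_intros LIMSEQ_Suc[OF lim_1_over_n])
  then have "norm (x - v) \<le> d"
    using LIMSEQ_le_const[of r d "norm (x - v)"] v d0 by (auto simp: A_def dist_norm)
  then show ?thesis
    using v dle order_trans by (metis A_def IntD1)
qed

text \<open>
  Moving the closest vector \<open>v\<close> along \<open>w\<close> by the real amount \<open>t\<close> cannot decrease the distance; for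
  \<open>t = \<langle>x - v, w\<rangle> / \<parallel>w\<parallel>\<^sup>2\<close> it would, unless the real inner product vanishes.
\<close>
lemma orthogonal_projection_exists:
  fixes V :: "'a::chilbert_space set"
  assumes V: "csubspace V" "closed V"
  shows "\<exists>v\<in>V. \<forall>w\<in>V. cinner (x - v) w = 0"
proof -
  have sV: "subspace V" using V(1) by (rule csubspace_imp_subspace)
  obtain v where v: "v \<in> V" and min: "\<And>w. w \<in> V \<Longrightarrow> norm (x - v) \<le> norm (x - w)"
    using closest_vector_exists[OF sV V(2)] by blast
  have real: "inner (x - v) w = 0" if w: "w \<in> V" for w
  proof (cases "w = 0")
    case False
    define t where "t = inner (x - v) w / (norm w)\<^sup>2"
    have "v + t *\<^sub>R w \<in> V" using sV v w by (simp add: subspace_add subspace_scale)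
    then have "(norm (x - v))\<^sup>2 \<le> (norm (x - (v + t *\<^sub>R w)))\<^sup>2"
      by (intro power_mono min) auto
    also have "\<dots> = (norm ((x - v) - t *\<^sub>R w))\<^sup>2" by (simp add: algebra_simps)
    also have "\<dots> = (norm (x - v))\<^sup>2 - 2 * t * inner (x - v) w + t\<^sup>2 * (norm w)\<^sup>2"
      unfolding power2_norm_eq_inner
      by (simp add: inner_diff_left inner_diff_right inner_commute algebra_simps power2_eq_square)
    also have "\<dots> = (norm (x - v))\<^sup>2 - (inner (x - v) w)\<^sup>2 / (norm w)\<^sup>2"
      using False by (simp add: t_def field_simps power2_eq_square)
    finally show ?thesis using False by (simp add: field_simps)
  qed simp
  \<comment> \<open>The real part of \<open>\<langle>u, \<i> w\<rangle>\<close> is the imaginary part of \<open>\<langle>u, w\<rangle>\<close>.\<close>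
  have "cinner (x - v) w = 0" if w: "w \<in> V" for w
  proof -
    have "\<i> *\<^sub>C w \<in> V" using V(1) w by (simp add: complex_vector.subspace_scale)
    from real[OF this] real[OF w] show ?thesis
      by (simp add: Re_cinner[symmetric] cinner_scaleC_right complex_eq_iff)
  qed
  with v show ?thesis by blast
qed

definition ominus :: "'a::complex_inner set \<Rightarrow> 'a set \<Rightarrow> 'a set" (infixl "\<ominus>" 65) where
  "M \<ominus> K = {u\<in>M. \<forall>k\<in>K. cinner u k = 0}"

lemma csubspace_ominus: "csubspace M \<Longrightarrow> csubspace (M \<ominus> K)"
  by (auto simp: ominus_def complex_vector.subspace_def cinner_add_left cinner_scaleC_left
      cinner_zero_left)

lemma closed_ominus:
  assumes "closed M"
  shows "closed (M \<ominus> K)"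
proof -
  have "M \<ominus> K = M \<inter> (\<Inter>k\<in>K. {u. cinner u k = 0})" by (auto simp: ominus_def)
  also have "closed \<dots>"
    by (intro closed_Int closed_INT closed_Collect_eq ballI assms
        linear_continuous_on bounded_linear_cinner_left continuous_on_const)
  finally show ?thesis .
qed

lemma ominus_decomposition:
  fixes M K :: "'a::chilbert_space set"
  assumes "csubspace M" "csubspace K" "closed K" "K \<subseteq> M" "u \<in> M"
  obtains a b where "a \<in> M \<ominus> K" "b \<in> K" "u = a + b"
proof -
  obtain b where b: "b \<in> K" "\<forall>w\<in>K. cinner (u - b) w = 0"
    using orthogonal_projection_exists[OF assms(2,3)] by blast
  then have "u - b \<in> M \<ominus> K"
    using assms by (auto simp: ominus_def intro: complex_vector.subspace_diff)
  from that[OF this b(1)] show ?thesis by simp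
qed


section \<open>Coefficients, evaluation and the shift on the Hardy space\<close>

lemma bounded_linear_hcoeff: "bounded_linear (\<lambda>f :: 'a::complex_inner hardy. hcoeff f n)"
  by (rule bounded_linear_intro[where K = 1])
    (simp_all add: plus_hardy.rep_eq hcoeff_scaleR norm_hcoeff_le)

lemma hardy_eval_add:
  assumes "cmod z < 1"
  shows "hardy_eval (f + g) z = hardy_eval f z + hardy_eval g z"
  using assms by (simp add: hardy_eval_def plus_hardy.rep_eq scaleC_add_right
      suminf_add[OF summable_hardy_eval summable_hardy_eval])

lemma hardy_eval_scaleC:
  assumes "cmod z < 1"
  shows "hardy_eval (c *\<^sub>C f) z = c *\<^sub>C hardy_eval f z"
proof -
  have "hardy_eval (c *\<^sub>C f) z = (\<Sum>n. c *\<^sub>C ((z ^ n) *\<^sub>C hcoeff f n))"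
    by (simp add: hardy_eval_def scaleC_hardy.rep_eq scaleC_scaleC mult.commute)
  also have "\<dots> = c *\<^sub>C hardy_eval f z"
    unfolding hardy_eval_def
    by (rule bounded_linear.suminf[OF bounded_linear_scaleC summable_hardy_eval[OF assms], symmetric])
  finally show ?thesis .
qed

lemma hardy_eval_scaleR:
  "cmod z < 1 \<Longrightarrow> hardy_eval (r *\<^sub>R f) z = r *\<^sub>R hardy_eval f z"
  by (simp add: scaleR_scaleC hardy_eval_scaleC)

text \<open>
  For \<open>\<bar>z\<bar> < 1\<close> this is the Szego kernel \<open>w \<mapsto> (1 - cnj z w)\<^sup>-\<^sup>1 v\<close>, which reproduces values at \<open>z\<close>.
\<close>
definition hardy_kernel :: "complex \<Rightarrow> 'a::complex_inner \<Rightarrow> 'a hardy" where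
  "hardy_kernel z v = Abs_hardy (\<lambda>n. (cnj z ^ n) *\<^sub>C v)"

lemma geometric_cmod_sums:
  assumes "cmod z < 1"
  shows "(\<lambda>n. (norm ((z ^ n) *\<^sub>C v))\<^sup>2) sums ((norm (v :: 'a::complex_inner))\<^sup>2 / (1 - (cmod z)\<^sup>2))"
proof -
  have "(\<lambda>n. (norm v)\<^sup>2 * ((cmod z)\<^sup>2) ^ n) sums ((norm v)\<^sup>2 * (1 / (1 - (cmod z)\<^sup>2)))"
    using assms by (intro sums_mult geometric_sums) (simp add: abs_square_less_1)
  then show ?thesis
    by (simp add: norm_scaleC norm_power power_mult_distrib power_mult[symmetric] mult.commute)
qed

lemma hcoeff_kernel: "cmod z < 1 \<Longrightarrow> hcoeff (hardy_kernel z v) n = (cnj z ^ n) *\<^sub>C v"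
  using sums_summable[OF geometric_cmod_sums[of "cnj z" v]]
  by (simp add: hardy_kernel_def Abs_hardy_inverse)

lemma norm_kernel: "cmod z < 1 \<Longrightarrow> (norm (hardy_kernel z v))\<^sup>2 = (norm v)\<^sup>2 / (1 - (cmod z)\<^sup>2)"
  using sums_unique[OF geometric_cmod_sums[of "cnj z" v]]
  by (simp add: norm_hardy_square hcoeff_kernel)

lemma cinner_kernel:
  assumes "cmod z < 1"
  shows "cinner f (hardy_kernel z v) = cinner (hardy_eval f z) v"
proof -
  have "cinner f (hardy_kernel z v) = (\<Sum>n. cinner ((z ^ n) *\<^sub>C hcoeff f n) v)"
    by (simp add: cinner_hardy_def hcoeff_kernel[OF assms] cinner_scaleC_left cinner_scaleC_right)
  also have "\<dots> = cinner (hardy_eval f z) v"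
    unfolding hardy_eval_def
    by (rule bounded_linear.suminf[OF bounded_linear_cinner_left summable_hardy_eval[OF assms], symmetric])
  finally show ?thesis .
qed

text \<open>Cauchy-Schwarz against the kernel that reproduces the value at \<open>z\<close>.\<close>
lemma norm_hardy_eval_le:
  assumes "cmod z < 1"
  shows "(norm (hardy_eval f z))\<^sup>2 * (1 - (cmod z)\<^sup>2) \<le> (norm f)\<^sup>2"
proof (cases "hardy_eval f z = 0")
  case False
  define v where "v = hardy_eval f z"
  have c: "0 < 1 - (cmod z)\<^sup>2" using assms by (simp add: abs_square_less_1)
  have "(norm v)\<^sup>2 = cmod (cinner f (hardy_kernel z v))"
    by (simp add: cinner_kernel[OF assms] v_def cinner_self norm_power)
  also have "\<dots> \<le> norm f * norm (hardy_kernel z v)" by (rule cmod_cinner_le)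
  finally have "((norm v)\<^sup>2)\<^sup>2 \<le> (norm f * norm (hardy_kernel z v))\<^sup>2"
    by (rule power_mono) simp
  also have "\<dots> = (norm f)\<^sup>2 * ((norm v)\<^sup>2 / (1 - (cmod z)\<^sup>2))"
    by (simp add: power_mult_distrib norm_kernel[OF assms])
  finally have "(norm v)\<^sup>2 * ((norm v)\<^sup>2 * (1 - (cmod z)\<^sup>2)) \<le> (norm v)\<^sup>2 * (norm f)\<^sup>2"
    using c by (simp add: field_simps power2_eq_square)
  then show ?thesis
    unfolding v_def[symmetric] by (rule mult_left_le_imp_le) (use False in \<open>simp add: v_def\<close>)
qed simp

lemma bounded_linear_hardy_eval:
  assumes "cmod z < 1"
  shows "bounded_linear (\<lambda>f. hardy_eval f z)"
proof (rule bounded_linear_intro[where K = "1 / sqrt (1 - (cmod z)\<^sup>2)"])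
  fix f :: "'a hardy"
  have c: "0 < 1 - (cmod z)\<^sup>2" using assms by (simp add: abs_square_less_1)
  have "sqrt ((norm (hardy_eval f z))\<^sup>2 * (1 - (cmod z)\<^sup>2)) \<le> sqrt ((norm f)\<^sup>2)"
    using norm_hardy_eval_le[OF assms] by (rule real_sqrt_le_mono)
  then show "norm (hardy_eval f z) \<le> norm f * (1 / sqrt (1 - (cmod z)\<^sup>2))"
    using c by (simp only: real_sqrt_mult real_sqrt_abs abs_norm_cancel) (simp add: pos_le_divide_eq)
qed (simp_all add: assms hardy_eval_add hardy_eval_scaleR)

lemma hardy_eval_kernel:
  assumes "cmod z < 1"
  shows "hardy_eval (hardy_kernel z v) z = (1 / (1 - (cmod z)\<^sup>2)) *\<^sub>R v"
proof -
  have "(\<lambda>n. complex_of_real (((cmod z)\<^sup>2) ^ n)) sums complex_of_real (1 / (1 - (cmod z)\<^sup>2))"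
    using assms by (intro sums_of_real geometric_sums) (simp add: abs_square_less_1)
  then have "(\<lambda>n. z ^ n * cnj z ^ n) sums complex_of_real (1 / (1 - (cmod z)\<^sup>2))"
    by (simp add: power_mult_distrib[symmetric] complex_norm_square[symmetric])
  from bounded_linear.sums[OF bounded_linear_scaleC_left this, of v]
  show ?thesis
    by (simp add: hardy_eval_def hcoeff_kernel[OF assms] scaleC_scaleC scaleR_scaleC sums_iff)
qed

text \<open>
  The scalar power series \<open>\<Sum>\<^sub>n \<langle>f\<^sub>n, v\<rangle> z\<^sup>n\<close> vanishes on the disc for each vector \<open>v\<close>, in particular
  for \<open>v = f\<^sub>m\<close>, whose \<open>m\<close>-th coefficient is \<open>\<parallel>f\<^sub>m\<parallel>\<^sup>2\<close>.
\<close>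
lemma hardy_eval_zero_imp_zero:
  fixes f :: "'a::chilbert_space hardy"
  assumes "\<And>z. cmod z < 1 \<Longrightarrow> hardy_eval f z = 0"
  shows "f = 0"
proof (rule hardy_eqI)
  fix m
  define a where "a n = cinner (hcoeff f n) (hcoeff f m)" for n
  have a: "(\<lambda>n. a n * z ^ n) sums 0" if "norm z < 1" for z
  proof -
    have "(\<lambda>n. (z ^ n) *\<^sub>C hcoeff f n) sums 0"
      using assms[OF that] summable_sums[OF summable_hardy_eval[OF that, of f]]
      by (simp add: hardy_eval_def)
    from bounded_linear.sums[OF bounded_linear_cinner_left this, of "hcoeff f m"]
    show ?thesis
      by (simp add: a_def cinner_scaleC_left mult.commute
          cinner_zero_left)
  qed
  have "Abs_fps a = 0"
  proof (rule eval_fps_eqD)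
    have "norm (1/2 :: complex) \<le> conv_radius a"
      by (intro conv_radius_geI sums_summable[OF a]) simp
    then have "ereal 0 < conv_radius a"
      by (rule less_le_trans[rotated]) simp
    then show "0 < fps_conv_radius (Abs_fps a)" by (simp add: fps_conv_radius_def zero_ereal_def)
    show "0 < fps_conv_radius (0 :: complex fps)" by simp
    have "\<forall>\<^sub>F z :: complex in nhds 0. z \<in> ball 0 1"
      by (rule eventually_nhds_in_open) auto
    then show "\<forall>\<^sub>F z in nhds 0. eval_fps (Abs_fps a) z = eval_fps 0 z"
      by eventually_elim (use a in \<open>simp add: eval_fps_def sums_iff\<close>)
  qed
  then have "a m = 0" by (simp add: fps_eq_iff)
  then show "hcoeff f m = hcoeff 0 m"
    by (simp add: a_def cinner_self zero_hardy.rep_eq)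
qed

lemma hardy_eval_diff:
  "cmod z < 1 \<Longrightarrow> hardy_eval (f - g) z = hardy_eval f z - hardy_eval g z"
  by (rule linear_diff[OF bounded_linear.linear[OF bounded_linear_hardy_eval]])

lemma hardy_eval_inject:
  assumes "\<And>z. cmod z < 1 \<Longrightarrow> hardy_eval f z = hardy_eval g z"
  shows "f = g"
  using hardy_eval_zero_imp_zero[of "f - g"] assms by (simp add: hardy_eval_diff)

lemma hcoeff_shift_Suc: "hcoeff (hardy_shift f) (Suc n) = hcoeff f n"
  and hcoeff_shift_0: "hcoeff (hardy_shift f) 0 = 0"
  by (simp_all add: hardy_shift.rep_eq)

lemma hardy_shift_add: "hardy_shift (f + g) = hardy_shift f + hardy_shift g"
  by (rule hardy_eqI) (simp add: hardy_shift.rep_eq plus_hardy.rep_eq split: nat.split)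

lemma hardy_shift_scaleC: "hardy_shift (c *\<^sub>C f) = c *\<^sub>C hardy_shift f"
  by (rule hardy_eqI) (simp add: hardy_shift.rep_eq scaleC_hardy.rep_eq split: nat.split)

lemma hardy_shift_0: "hardy_shift 0 = 0"
  by (rule hardy_eqI) (simp add: hardy_shift.rep_eq zero_hardy.rep_eq split: nat.split)

lemma hardy_const_0: "hardy_const 0 = 0"
  by (rule hardy_eqI) (simp add: hardy_const.rep_eq zero_hardy.rep_eq)

lemma hardy_const_add: "hardy_const (x + y) = hardy_const x + hardy_const y"
  by (rule hardy_eqI) (simp add: hardy_const.rep_eq plus_hardy.rep_eq)

lemma hardy_const_scaleC: "hardy_const (c *\<^sub>C x) = c *\<^sub>C hardy_const x"
  by (rule hardy_eqI) (simp add: hardy_const.rep_eq scaleC_hardy.rep_eq)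

lemma cinner_shift_shift: "cinner (hardy_shift f) (hardy_shift g) = cinner f g"
  using suminf_split_head[OF summable_cinner_hcoeff, of "hardy_shift f" "hardy_shift g"]
  by (simp add: cinner_hardy_def hcoeff_shift_Suc hcoeff_shift_0
      cinner_zero_left)

lemma norm_shift: "norm (hardy_shift f) = norm f"
  by (simp add: norm_eq_sqrt_inner Re_cinner[symmetric] cinner_shift_shift)

lemma cinner_const_shift: "cinner (hardy_const x) (hardy_shift f) = 0"
proof -
  have "cinner (hcoeff (hardy_const x) n) (hcoeff (hardy_shift f) n) = 0" for n
    by (cases n) (simp_all add: hardy_const.rep_eq hcoeff_shift_0 cinner_commute[of x]
      cinner_zero_left)
  then show ?thesis by (simp add: cinner_hardy_def)
qed

lemma bounded_linear_shift: "bounded_linear (hardy_shift :: 'a::complex_inner hardy \<Rightarrow> 'a hardy)"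
  by (rule bounded_linear_intro[where K = 1])
    (simp_all add: hardy_shift_add scaleR_scaleC hardy_shift_scaleC norm_shift)

lemma norm_const: "norm (hardy_const x) = norm x"
proof -
  have "(norm (hardy_const x))\<^sup>2 = (\<Sum>n\<in>{0}. (norm (hcoeff (hardy_const x) n))\<^sup>2)"
    unfolding norm_hardy_square by (rule suminf_finite) (auto simp: hardy_const.rep_eq)
  then show ?thesis by (simp add: hardy_const.rep_eq)
qed

lemma bounded_linear_const: "bounded_linear (hardy_const :: 'a::complex_inner \<Rightarrow> 'a hardy)"
  by (rule bounded_linear_intro[where K = 1])
    (simp_all add: hardy_const_add scaleR_scaleC hardy_const_scaleC norm_const)


section \<open>Analyticity in the operator norm\<close>

text \<open>
  Both the derivative of \<open>f\<close> at a point and the error of a difference quotient against it are of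
  this form, so one norm bound serves for the two.
\<close>
definition coeff_combination :: "(nat \<Rightarrow> complex) \<Rightarrow> 'a::chilbert_space hardy \<Rightarrow> 'a" where
  "coeff_combination d f = (\<Sum>n. d n *\<^sub>C hcoeff f n)"

lemma norm_coeff_term_le: "norm (d n *\<^sub>C hcoeff f n) \<le> cmod (d n) * norm f"
  by (simp add: norm_scaleC mult_left_mono norm_hcoeff_le)

lemma summable_coeff_combination:
  fixes f :: "'a::chilbert_space hardy"
  assumes "summable (\<lambda>n. cmod (d n))"
  shows "summable (\<lambda>n. norm (d n *\<^sub>C hcoeff f n))" "summable (\<lambda>n. d n *\<^sub>C hcoeff f n)"
proof -
  show "summable (\<lambda>n. norm (d n *\<^sub>C hcoeff f n))"
    by (rule summable_comparison_test'[OF summable_mult2[OF assms, of "norm f"]])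
      (simp add: norm_coeff_term_le)
  then show "summable (\<lambda>n. d n *\<^sub>C hcoeff f n)" by (rule summable_norm_cancel)
qed

lemma norm_coeff_combination_le:
  assumes "summable (\<lambda>n. cmod (d n))"
  shows "norm (coeff_combination d f) \<le> (\<Sum>n. cmod (d n)) * norm f"
proof -
  have "norm (coeff_combination d f) \<le> (\<Sum>n. norm (d n *\<^sub>C hcoeff f n))"
    unfolding coeff_combination_def by (rule summable_norm[OF summable_coeff_combination(1)[OF assms]])
  also have "\<dots> \<le> (\<Sum>n. cmod (d n) * norm f)"
    by (intro suminf_le norm_coeff_term_le summable_coeff_combination assms summable_mult2)
  also have "\<dots> = (\<Sum>n. cmod (d n)) * norm f"
    by (rule suminf_mult2[OF assms, symmetric])
  finally show ?thesis .
qed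

lemma bounded_operator_on_coeff_combination:
  assumes "summable (\<lambda>n. cmod (d n))"
  shows "bounded_operator_on S (coeff_combination d)"
proof -
  note sm = summable_coeff_combination(2)[OF assms]
  have "coeff_combination d (f + g) = coeff_combination d f + coeff_combination d g" for f g :: "'a hardy"
    by (simp add: coeff_combination_def plus_hardy.rep_eq scaleC_add_right suminf_add[OF sm sm])
  moreover have "coeff_combination d (c *\<^sub>C f) = c *\<^sub>C coeff_combination d f" for c and f :: "'a hardy"
  proof -
    have "coeff_combination d (c *\<^sub>C f) = (\<Sum>n. c *\<^sub>C (d n *\<^sub>C hcoeff f n))"
      by (simp add: coeff_combination_def scaleC_hardy.rep_eq scaleC_scaleC mult.commute)
    also have "\<dots> = c *\<^sub>C coeff_combination d f"
      unfolding coeff_combination_def by (rule bounded_linear.suminf[OF bounded_linear_scaleC sm, symmetric])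
    finally show ?thesis .
  qed
  ultimately show ?thesis
    unfolding bounded_operator_on_def using norm_coeff_combination_le[OF assms] by blast
qed

lemma summable_first_derivative:
  assumes "cmod z < 1"
  shows "summable (\<lambda>n. cmod (of_nat n * z ^ (n - 1)))"
proof -
  have "summable (\<lambda>n. diffs (\<lambda>_. 1::real) n * cmod z ^ n)"
    by (rule termdiff_converges[where K = 1]) (use assms in \<open>auto intro: summable_geometric\<close>)
  then have "summable (\<lambda>n. cmod (of_nat (Suc n) * z ^ (Suc n - 1)))"
    by (simp add: diffs_def norm_mult norm_power del: of_nat_Suc)
  then show ?thesis by (subst (asm) summable_Suc_iff)
qed

lemma summable_second_derivative:
  assumes "0 \<le> K" "K < (1::real)"
  shows "summable (\<lambda>n. real n * real (n - 1) * K ^ (n - 2))"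
proof -
  have 1: "summable (\<lambda>n. diffs (\<lambda>_. 1::real) n * x ^ n)" if "norm x < 1" for x
    by (rule termdiff_converges[where K = 1]) (use that in \<open>auto intro: summable_geometric\<close>)
  have "summable (\<lambda>n. diffs (diffs (\<lambda>_. 1::real)) n * K ^ n)"
    by (rule termdiff_converges[where K = 1]) (use assms 1 in auto)
  then have "summable (\<lambda>n. real (n + 2) * real (n + 2 - 1) * K ^ (n + 2 - 2))"
    by (simp add: diffs_def mult.commute mult.left_commute)
  then show ?thesis by (subst (asm) summable_iff_shift)
qed

text \<open>
  Since \<open>\<parallel>f\<^sub>n\<parallel> \<le> \<parallel>f\<parallel>\<close> for all \<open>n\<close>, the scalar estimate for the difference quotients of the monomials
  \<open>z\<^sup>n\<close> gives an estimate for those of \<open>f\<close> that is uniform over the unit ball of the Hardy space.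
\<close>
lemma hardy_eval_operator_derivative:
  assumes z: "cmod z < 1" and e: "e > 0"
  shows "\<forall>\<^sub>F w in at z. \<forall>f :: 'a::chilbert_space hardy.
    norm (inverse (w - z) *\<^sub>C (hardy_eval f w - hardy_eval f z)
      - coeff_combination (\<lambda>n. of_nat n * z ^ (n - 1)) f) \<le> e * norm f"
proof -
  define K where "K = (1 + cmod z) / 2"
  have K: "0 \<le> K" "K < 1" "cmod z < K" using z by (auto simp: K_def)
  define b where "b n = real n * real (n - 1) * K ^ (n - 2)" for n
  have b: "summable b" unfolding b_def by (rule summable_second_derivative[OF K(1,2)])
  define B where "B = suminf b"
  have B0: "B \<ge> 0" unfolding B_def using K by (intro suminf_nonneg b) (simp add: b_def)
  define r where "r = min (K - cmod z) (e / (B + 1))"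
  have r: "r > 0" using K e B0 by (auto simp: r_def)
  have "norm (inverse (w - z) *\<^sub>C (hardy_eval f w - hardy_eval f z)
      - coeff_combination (\<lambda>n. of_nat n * z ^ (n - 1)) f) \<le> e * norm f"
    if w: "w \<noteq> z" "dist w z < r" for w and f :: "'a hardy"
  proof -
    have wK: "cmod w \<le> K" "cmod w < 1"
      using w(2) norm_triangle_sub[of w z] K by (auto simp: r_def dist_norm)
    define q where "q n = (w ^ n - z ^ n) / (w - z) - of_nat n * z ^ (n - 1)" for n
    have qb: "cmod (q n) \<le> b n * cmod (w - z)" for n
      using lemma_termdiff3[of "w - z" z K n] w(1) wK K by (simp add: q_def b_def)
    have bw: "summable (\<lambda>n. b n * cmod (w - z))" by (rule summable_mult2[OF b])
    have q: "summable (\<lambda>n. cmod (q n))"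
      by (rule summable_comparison_test'[OF bw]) (simp add: qb)
    let ?d = "\<lambda>n. of_nat n * z ^ (n - 1)"
    note sm = summable_hardy_eval[OF wK(2), of f] summable_hardy_eval[OF z, of f]
      summable_coeff_combination(2)[OF summable_first_derivative[OF z], of f]
    have quotient: "inverse (w - z) *\<^sub>C (hardy_eval f w - hardy_eval f z) =
        (\<Sum>n. inverse (w - z) *\<^sub>C (w ^ n *\<^sub>C hcoeff f n - z ^ n *\<^sub>C hcoeff f n))"
      unfolding hardy_eval_def suminf_diff[OF sm(1,2)]
      by (rule bounded_linear.suminf[OF bounded_linear_scaleC summable_diff[OF sm(1,2)]])
    have "inverse (w - z) *\<^sub>C (hardy_eval f w - hardy_eval f z) - coeff_combination ?d f =
        (\<Sum>n. inverse (w - z) *\<^sub>C (w ^ n *\<^sub>C hcoeff f n - z ^ n *\<^sub>C hcoeff f n) - ?d n *\<^sub>C hcoeff f n)"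
      unfolding coeff_combination_def quotient
      by (rule suminf_diff[OF bounded_linear.summable[OF bounded_linear_scaleC
              summable_diff[OF sm(1,2)]] sm(3)])
    also have "\<dots> = coeff_combination q f"
      unfolding coeff_combination_def
      by (rule arg_cong[where f = suminf], rule ext)
        (simp only: q_def scaleC_scaleC divide_inverse_commute
          complex_vector.scale_left_diff_distrib[symmetric])
    finally have "norm (inverse (w - z) *\<^sub>C (hardy_eval f w - hardy_eval f z) - coeff_combination ?d f)
        \<le> (\<Sum>n. cmod (q n)) * norm f"
      using norm_coeff_combination_le[OF q] by simp
    also have "\<dots> \<le> (\<Sum>n. b n * cmod (w - z)) * norm f"
      by (intro mult_right_mono suminf_le qb q bw norm_ge_zero)
    also have "(\<Sum>n. b n * cmod (w - z)) = B * cmod (w - z)"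
      unfolding B_def by (rule suminf_mult2[OF b, symmetric])
    also have "B * cmod (w - z) * norm f \<le> e * norm f"
    proof (rule mult_right_mono)
      have "B * cmod (w - z) \<le> (B + 1) * (e / (B + 1))"
        using w(2) B0 by (intro mult_mono) (auto simp: r_def dist_norm)
      then show "B * cmod (w - z) \<le> e" using B0 by simp
    qed simp
    finally show ?thesis .
  qed
  then show ?thesis
    unfolding eventually_at using r by blast
qed

lemma hardy_eval_in_H_infinity:
  fixes S :: "'a::chilbert_space hardy set"
  assumes bound: "\<And>z f. cmod z < 1 \<Longrightarrow> f \<in> S \<Longrightarrow> norm (hardy_eval f z) \<le> K * norm f"
  shows "(\<lambda>z f. hardy_eval f z) \<in> H_infinity S"
  unfolding H_infinity_def
proof (intro CollectI conjI ballI)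
  fix z :: complex assume "z \<in> ball 0 1"
  then have z: "cmod z < 1" by simp
  show "bounded_operator_on S (\<lambda>f. hardy_eval f z)"
    unfolding bounded_operator_on_def using bound[OF z] hardy_eval_add[OF z] hardy_eval_scaleC[OF z]
    by blast
  show "\<exists>D. bounded_operator_on S D \<and> (\<forall>e>0. \<forall>\<^sub>F w in at z. \<forall>x\<in>S.
      norm (inverse (w - z) *\<^sub>C (hardy_eval x w - hardy_eval x z) - D x) \<le> e * norm x)"
  proof (intro exI conjI allI impI)
    show "bounded_operator_on S (coeff_combination (\<lambda>n. of_nat n * z ^ (n - 1)))"
      by (rule bounded_operator_on_coeff_combination[OF summable_first_derivative[OF z]])
    show "\<forall>\<^sub>F w in at z. \<forall>x\<in>S. norm (inverse (w - z) *\<^sub>C (hardy_eval x w - hardy_eval x z)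
        - coeff_combination (\<lambda>n. of_nat n * z ^ (n - 1)) x) \<le> e * norm x" if "e > 0" for e
      using hardy_eval_operator_derivative[OF z that] by (rule eventually_mono) blast
  qed
next
  show "\<exists>K. \<forall>z\<in>ball 0 1. \<forall>x\<in>S. norm (hardy_eval x z) \<le> K * norm x"
    by (intro exI[of _ K]) (simp add: bound)
qed


section \<open>The wandering subspace of a shift-invariant subspace\<close>

lemma funpow_shift_add: "(hardy_shift ^^ k) (f + g) = (hardy_shift ^^ k) f + (hardy_shift ^^ k) g"
  by (induction k) (simp_all add: hardy_shift_add)

lemma cinner_funpow_shift: "cinner ((hardy_shift ^^ k) f) ((hardy_shift ^^ k) g) = cinner f g"
  by (induction k) (simp_all add: cinner_shift_shift)

lemma norm_funpow_shift: "norm ((hardy_shift ^^ k) f) = norm f"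
  by (induction k) (simp_all add: norm_shift)

lemma hcoeff_funpow_shift: "n < k \<Longrightarrow> hcoeff ((hardy_shift ^^ k) f) n = 0"
  by (induction k arbitrary: n) (auto simp: hardy_shift.rep_eq split: nat.split)

lemma hardy_eval_funpow_shift:
  "cmod z < 1 \<Longrightarrow> hardy_eval ((hardy_shift ^^ k) f) z = z ^ k *\<^sub>C hardy_eval f z"
  by (induction k) (simp_all add: hardy_eval_shift scaleC_one scaleC_scaleC)

locale shift_invariant =
  fixes N :: "'a::chilbert_space hardy set"
  assumes csubspace_N: "csubspace N" and closed_N: "closed N"
    and shift_N: "f \<in> N \<Longrightarrow> hardy_shift f \<in> N"
begin

definition wandering :: "'a hardy set" where
  "wandering = N \<ominus> (hardy_shift ` N)"

lemma wanderingI: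
  assumes "a \<in> N" "\<And>f. f \<in> N \<Longrightarrow> cinner a (hardy_shift f) = 0"
  shows "a \<in> wandering"
  using assms by (auto simp: wandering_def ominus_def)

lemma wandering_subset: "wandering \<subseteq> N"
  by (auto simp: wandering_def ominus_def)

lemma csubspace_wandering: "csubspace wandering"
  unfolding wandering_def by (rule csubspace_ominus[OF csubspace_N])

lemma hilbert_subspace_wandering: "hilbert_subspace wandering"
  unfolding hilbert_subspace_def using csubspace_wandering
  by (simp add: wandering_def closed_ominus closed_N)

lemma funpow_shift_N: "f \<in> N \<Longrightarrow> (hardy_shift ^^ k) f \<in> N"
  by (induction k) (simp_all add: shift_N)

text \<open>
  Cancelling the smaller power of the shift leaves \<open>a \<bottom> z b'\<close> with \<open>b' \<in> N\<close>.
\<close>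
lemma cinner_funpow_shift_wandering:
  assumes ab: "a \<in> wandering" "b \<in> wandering" and "j \<noteq> k"
  shows "cinner ((hardy_shift ^^ j) a) ((hardy_shift ^^ k) b) = 0"
proof -
  have less: "cinner ((hardy_shift ^^ j) a) ((hardy_shift ^^ k) b) = 0"
    if ab: "a \<in> wandering" "b \<in> wandering" and "j < k" for a b j k
  proof -
    obtain d where k: "k = j + Suc d" using \<open>j < k\<close> less_iff_Suc_add by auto
    have "b \<in> N" using ab wandering_subset by blast
    then have "cinner a (hardy_shift ((hardy_shift ^^ d) b)) = 0"
      using ab(1) funpow_shift_N by (auto simp: wandering_def ominus_def)
    then show ?thesis
      unfolding k funpow_add comp_apply cinner_funpow_shift by simp
  qed
  then show ?thesis
    using assms less[OF ab, of j k] less[OF ab(2,1), of k j]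
    by (metis cinner_commute complex_cnj_zero linorder_neqE_nat)
qed

text \<open>
  The argument is a power series whose coefficients are Hardy functions. The value of the sum at
  \<open>z\<close> is \<open>\<Sum>\<^sub>k z\<^sup>k f\<^sub>k(z)\<close>, so this is the product of \<open>f\<close> with the operator function that evaluates the
  elements of the wandering subspace at \<open>z\<close>.
\<close>
definition shifted_sum :: "'a hardy hardy \<Rightarrow> 'a hardy" where
  "shifted_sum f = (\<Sum>k. (hardy_shift ^^ k) (hcoeff f k))"

lemma norm_partial_shifted_sum:
  assumes f: "f \<in> hardy_on wandering" and "finite A"
  shows "(norm (\<Sum>k\<in>A. (hardy_shift ^^ k) (hcoeff f k)))\<^sup>2 = (\<Sum>k\<in>A. (norm (hcoeff f k))\<^sup>2)"
proof -
  have "pairwise (\<lambda>j k. orthogonal ((hardy_shift ^^ j) (hcoeff f j)) ((hardy_shift ^^ k) (hcoeff f k))) A"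
    using f by (auto simp: pairwise_def orthogonal_def hardy_on_def Re_cinner[symmetric]
        cinner_funpow_shift_wandering)
  from norm_sum_Pythagorean[OF \<open>finite A\<close> this] show ?thesis
    by (simp add: norm_funpow_shift)
qed

lemma summable_shifted_sum:
  assumes f: "f \<in> hardy_on wandering"
  shows "summable (\<lambda>k. (hardy_shift ^^ k) (hcoeff f k))"
  unfolding summable_Cauchy
proof (intro allI impI)
  fix e :: real assume e: "e > 0"
  then have "e\<^sup>2 > 0" by simp
  with summable_hcoeff[of f] obtain N
    where N: "\<forall>m\<ge>N. \<forall>n. norm (\<Sum>k=m..<n. (norm (hcoeff f k))\<^sup>2) < e\<^sup>2"
    unfolding summable_Cauchy by blast
  have "norm (\<Sum>k=m..<n. (hardy_shift ^^ k) (hcoeff f k)) < e" if "m \<ge> N" for m n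
    using N that e norm_partial_shifted_sum[OF f, of "{m..<n}"]
    by (intro power2_less_imp_less[of _ e]) (auto simp: abs_of_nonneg sum_nonneg)
  then show "\<exists>N. \<forall>m\<ge>N. \<forall>n. norm (\<Sum>k=m..<n. (hardy_shift ^^ k) (hcoeff f k)) < e"
    by blast
qed

lemma partial_shifted_sum_tendsto:
  assumes f: "f \<in> hardy_on wandering"
  shows "(\<lambda>n. \<Sum>k<n. (hardy_shift ^^ k) (hcoeff f k)) \<longlonglongrightarrow> shifted_sum f"
  unfolding shifted_sum_def by (rule summable_LIMSEQ[OF summable_shifted_sum[OF f]])

lemma norm_shifted_sum:
  assumes f: "f \<in> hardy_on wandering"
  shows "norm (shifted_sum f) = norm f"
proof -
  have "(\<lambda>n. (norm (\<Sum>k<n. (hardy_shift ^^ k) (hcoeff f k)))\<^sup>2) \<longlonglongrightarrow> (norm (shifted_sum f))\<^sup>2"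
    by (intro tendsto_intros partial_shifted_sum_tendsto f)
  moreover have "(\<lambda>n. \<Sum>k<n. (norm (hcoeff f k))\<^sup>2) \<longlonglongrightarrow> (norm f)\<^sup>2"
    unfolding norm_hardy_square[of f] by (rule summable_LIMSEQ[OF summable_hcoeff])
  ultimately have "(norm (shifted_sum f))\<^sup>2 = (norm f)\<^sup>2"
    by (simp add: norm_partial_shifted_sum[OF f] LIMSEQ_unique)
  then show ?thesis by simp
qed

lemma shifted_sum_in_N:
  assumes f: "f \<in> hardy_on wandering"
  shows "shifted_sum f \<in> N"
proof (rule closed_sequentially[OF closed_N _ partial_shifted_sum_tendsto[OF f]])
  have "hcoeff f k \<in> N" for k
    using f wandering_subset by (auto simp: hardy_on_def)
  then show "(\<Sum>k<n. (hardy_shift ^^ k) (hcoeff f k)) \<in> N" for n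
    by (intro complex_vector.subspace_sum csubspace_N funpow_shift_N)
qed

lemma is_product_shifted_sum:
  assumes f: "f \<in> hardy_on wandering"
  shows "is_product (\<lambda>z a. hardy_eval a z) f (shifted_sum f)"
  unfolding is_product_def
proof
  fix z :: complex assume "z \<in> ball 0 1"
  then have z: "cmod z < 1" by simp
  have "hardy_eval (shifted_sum f) z = (\<Sum>k. hardy_eval ((hardy_shift ^^ k) (hcoeff f k)) z)"
    unfolding shifted_sum_def
    by (rule bounded_linear.suminf[OF bounded_linear_hardy_eval[OF z] summable_shifted_sum[OF f]])
  also have "\<dots> = (\<Sum>k. hardy_eval (z ^ k *\<^sub>C hcoeff f k) z)"
    by (simp add: hardy_eval_funpow_shift[OF z] hardy_eval_scaleC[OF z])
  also have "\<dots> = hardy_eval (hardy_eval f z) z"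
    unfolding hardy_eval_def[of f]
    by (rule bounded_linear.suminf[OF bounded_linear_hardy_eval[OF z] summable_hardy_eval[OF z], symmetric])
  finally show "hardy_eval (shifted_sum f) z = hardy_eval (hardy_eval f z) z" .
qed

text \<open>
  An isometric multiplier is bounded by \<open>1\<close>: the product with the kernel
  \<open>w \<mapsto> (1 - cnj z w)\<^sup>-\<^sup>1 a\<close> takes the value \<open>a(z) / (1 - \<bar>z\<bar>\<^sup>2)\<close> at \<open>z\<close> and has norm
  \<open>\<parallel>a\<parallel> / sqrt (1 - \<bar>z\<bar>\<^sup>2)\<close>, while evaluation at \<open>z\<close> has norm at most \<open>1 / sqrt (1 - \<bar>z\<bar>\<^sup>2)\<close>.
\<close>
lemma norm_hardy_eval_wandering_le:
  assumes z: "cmod z < 1" and a: "a \<in> wandering"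
  shows "norm (hardy_eval a z) \<le> norm a"
proof -
  define c where "c = 1 - (cmod z)\<^sup>2"
  have c: "c > 0" using z by (simp add: c_def abs_square_less_1)
  define f where "f = hardy_kernel z a"
  have f: "f \<in> hardy_on wandering"
    using a csubspace_wandering
    by (simp add: f_def hardy_on_def hcoeff_kernel[OF z] complex_vector.subspace_scale)
  have norm_f: "norm (shifted_sum f) = norm f" "(norm f)\<^sup>2 = (norm a)\<^sup>2 / c"
    using norm_shifted_sum[OF f] norm_kernel[OF z, of a] by (simp_all add: f_def c_def)
  have "hardy_eval (shifted_sum f) z = (1 / c) *\<^sub>R hardy_eval a z"
    using is_product_shifted_sum[OF f] z
    by (simp add: is_product_def f_def c_def hardy_eval_kernel[OF z] hardy_eval_scaleR[OF z])
  then have "(norm (hardy_eval a z) / c)\<^sup>2 * c \<le> (norm a)\<^sup>2 / c"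
    using norm_hardy_eval_le[OF z, of "shifted_sum f"] c
    by (simp add: norm_f c_def[symmetric])
  then have "(norm (hardy_eval a z))\<^sup>2 \<le> (norm a)\<^sup>2"
    using c by (simp add: field_simps power2_eq_square)
  then show ?thesis by (simp add: power2_le_iff_abs_le)
qed

lemma inner_function_wandering: "inner_function wandering (\<lambda>z a. hardy_eval a z)"
  unfolding inner_function_def
proof
  show "(\<lambda>z a. hardy_eval a z) \<in> H_infinity wandering"
    by (rule hardy_eval_in_H_infinity[where K = 1]) (simp add: norm_hardy_eval_wandering_le)
  show "\<forall>f\<in>hardy_on wandering. \<exists>h. is_product (\<lambda>z a. hardy_eval a z) f h \<and> norm h = norm f"
    using is_product_shifted_sum norm_shifted_sum by blast
qed

lemma closed_shift_image: "closed (hardy_shift ` N)"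
proof -
  have "complete (hardy_shift ` N)"
    by (rule complete_isometric_image[where e = 1])
      (use csubspace_N closed_N in
        \<open>auto simp: csubspace_imp_subspace bounded_linear_shift norm_shift complete_eq_closed\<close>)
  then show ?thesis by (rule complete_imp_closed)
qed

lemma csubspace_shift_image: "csubspace (hardy_shift ` N)"
proof -
  show ?thesis
  proof (rule complex_vector.subspaceI)
    show "0 \<in> hardy_shift ` N"
      using complex_vector.subspace_0[OF csubspace_N] hardy_shift_0 by force
    show "x + y \<in> hardy_shift ` N" if "x \<in> hardy_shift ` N" "y \<in> hardy_shift ` N" for x y
      using that by (auto simp: hardy_shift_add[symmetric] complex_vector.subspace_add[OF csubspace_N])
    show "c *\<^sub>C x \<in> hardy_shift ` N" if "x \<in> hardy_shift ` N" for c x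
      using that by (auto simp: hardy_shift_scaleC[symmetric] complex_vector.subspace_scale[OF csubspace_N])
  qed
qed

lemma wandering_step:
  assumes "n \<in> N"
  shows "\<exists>p. fst p \<in> wandering \<and> snd p \<in> N \<and> n = fst p + hardy_shift (snd p)"
proof -
  obtain a b where "a \<in> wandering" "b \<in> hardy_shift ` N" "n = a + b"
    unfolding wandering_def
    using ominus_decomposition[OF csubspace_N csubspace_shift_image closed_shift_image _ assms]
      shift_N by blast
  then show ?thesis by force
qed

text \<open>
  Iterating \<open>n = a + z n'\<close> yields \<open>n = \<Sum>\<^sub>j\<^sub><\<^sub>k z\<^sup>j a\<^sub>j + z\<^sup>k r\<^sub>k\<close>. The summands are orthogonal, so
  \<open>\<Sum>\<^sub>j \<parallel>a\<^sub>j\<parallel>\<^sup>2 \<le> \<parallel>n\<parallel>\<^sup>2\<close> and the \<open>a\<^sub>j\<close> are the coefficients of some \<open>f\<close>. The two sides agree because the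
  remainder does not contribute to the coefficients of order less than \<open>k\<close>.
\<close>
lemma N_subset_shifted_sums:
  assumes n: "n \<in> N"
  obtains f where "f \<in> hardy_on wandering" "shifted_sum f = n"
proof -
  obtain p where p: "\<And>m. m \<in> N \<Longrightarrow>
      fst (p m) \<in> wandering \<and> snd (p m) \<in> N \<and> m = fst (p m) + hardy_shift (snd (p m))"
    using wandering_step by metis
  define r where "r k = ((\<lambda>m. snd (p m)) ^^ k) n" for k
  define a where "a k = fst (p (r k))" for k
  have rN: "r k \<in> N" for k
    by (induction k) (simp_all add: r_def n p)
  have r0: "r 0 = n" by (simp add: r_def)
  have aW: "a k \<in> wandering" for k using p[OF rN] by (simp add: a_def)
  have step: "r k = a k + hardy_shift (r (Suc k))" for k
    using p[OF rN[of k]] by (simp add: r_def a_def)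
  have expand: "n = (\<Sum>j<k. (hardy_shift ^^ j) (a j)) + (hardy_shift ^^ k) (r k)" for k
  proof (induction k)
    case (Suc k)
    have "(hardy_shift ^^ k) (r k) = (hardy_shift ^^ k) (a k) + (hardy_shift ^^ Suc k) (r (Suc k))"
      by (subst step) (simp add: funpow_shift_add funpow_swap1)
    with Suc show ?case by (simp add: add.assoc)
  qed (simp add: r0)
  have norm_expand: "(\<Sum>j<k. (norm (a j))\<^sup>2) + (norm (r k))\<^sup>2 = (norm n)\<^sup>2" for k
  proof (induction k)
    case (Suc k)
    have "cinner (a k) (hardy_shift (r (Suc k))) = 0"
      using aW[of k] rN[of "Suc k"] by (auto simp: wandering_def ominus_def)
    then have "inner (a k) (hardy_shift (r (Suc k))) = 0" by (simp add: Re_cinner[symmetric])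
    then have "(norm (r k))\<^sup>2 = (norm (a k))\<^sup>2 + (norm (r (Suc k)))\<^sup>2"
      by (subst step) (simp add: norm_add_Pythagorean orthogonal_def norm_shift)
    with Suc show ?case by simp
  qed (simp add: r0)
  have "summable (\<lambda>k. (norm (a k))\<^sup>2)"
  proof (rule summableI_nonneg_bounded)
    show "(\<Sum>j<k. (norm (a j))\<^sup>2) \<le> (norm n)\<^sup>2" for k
      using norm_expand[of k] zero_le_power2[of "norm (r k)"] by linarith
  qed simp
  then obtain f where fa: "hcoeff f = a"
    using Abs_hardy_inverse[of a] by auto
  have f: "f \<in> hardy_on wandering" using aW by (simp add: hardy_on_def fa)
  have "shifted_sum f = n"
  proof (rule hardy_eqI)
    fix m
    have "hcoeff (shifted_sum f) m = (\<Sum>k. hcoeff ((hardy_shift ^^ k) (a k)) m)"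
      unfolding shifted_sum_def fa[symmetric]
      by (rule bounded_linear.suminf[OF bounded_linear_hcoeff summable_shifted_sum[OF f]])
    also have "\<dots> = (\<Sum>k<Suc m. hcoeff ((hardy_shift ^^ k) (a k)) m)"
      by (rule suminf_finite) (auto intro: hcoeff_funpow_shift)
    also have "\<dots> = hcoeff (\<Sum>k<Suc m. (hardy_shift ^^ k) (a k)) m"
      by (rule linear_sum[OF bounded_linear.linear[OF bounded_linear_hcoeff], symmetric])
    also have "\<dots> = hcoeff n m"
      using arg_cong[OF expand[of "Suc m"], of "\<lambda>f. hcoeff f m"]
      by (simp only: plus_hardy.rep_eq hcoeff_funpow_shift[OF lessI] add_0_right)
    finally show "hcoeff (shifted_sum f) m = hcoeff n m" .
  qed
  with f that show ?thesis by blast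
qed

theorem mult_range_wandering: "mult_range wandering (\<lambda>z a. hardy_eval a z) = N"
proof
  show "mult_range wandering (\<lambda>z a. hardy_eval a z) \<subseteq> N"
  proof
    fix h assume "h \<in> mult_range wandering (\<lambda>z a. hardy_eval a z)"
    then obtain f where f: "f \<in> hardy_on wandering" "is_product (\<lambda>z a. hardy_eval a z) f h"
      by (auto simp: mult_range_def)
    have "h = shifted_sum f"
      using f(2) is_product_shifted_sum[OF f(1)]
      by (intro hardy_eval_inject) (simp add: is_product_def)
    with shifted_sum_in_N[OF f(1)] show "h \<in> N" by simp
  qed
  show "N \<subseteq> mult_range wandering (\<lambda>z a. hardy_eval a z)"
    using N_subset_shifted_sums is_product_shifted_sum unfolding mult_range_def by blast
qed

end


section \<open>Invariant subspaces of the Brownian shift\<close>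

lemma hardy_eval_in_subspace:
  assumes S: "hilbert_subspace S" and f: "f \<in> hardy_on S" and z: "cmod z < 1"
  shows "hardy_eval f z \<in> S"
proof -
  have S': "csubspace S" "closed S" using S by (auto simp: hilbert_subspace_def)
  have "(\<lambda>n. \<Sum>k<n. (z ^ k) *\<^sub>C hcoeff f k) \<longlonglongrightarrow> hardy_eval f z"
    unfolding hardy_eval_def by (rule summable_LIMSEQ[OF summable_hardy_eval[OF z]])
  moreover have "(\<Sum>k<n. (z ^ k) *\<^sub>C hcoeff f k) \<in> S" for n
    using f by (intro complex_vector.subspace_sum complex_vector.subspace_scale S')
      (auto simp: hardy_on_def)
  ultimately show ?thesis by (rule closed_sequentially[OF S'(2), rotated])
qed

lemma shift_mult_range:
  assumes S: "hilbert_subspace S" and \<Phi>: "\<Phi> \<in> H_infinity S" and h: "h \<in> mult_range S \<Phi>"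
  shows "hardy_shift h \<in> mult_range S \<Phi>"
proof -
  obtain f where f: "f \<in> hardy_on S" "is_product \<Phi> f h"
    using h by (auto simp: mult_range_def)
  have "0 \<in> S" using S by (auto simp: hilbert_subspace_def complex_vector.subspace_0)
  then have "hardy_shift f \<in> hardy_on S"
    using f(1) by (auto simp: hardy_on_def hardy_shift.rep_eq split: nat.split)
  moreover have "is_product \<Phi> (hardy_shift f) (hardy_shift h)"
    unfolding is_product_def
  proof
    fix z :: complex assume z: "z \<in> ball 0 1"
    have "bounded_operator_on S (\<Phi> z)" using \<Phi> z by (simp add: H_infinity_def)
    moreover have "hardy_eval f z \<in> S" using hardy_eval_in_subspace[OF S f(1)] z by simp
    ultimately show "hardy_eval (hardy_shift h) z = \<Phi> z (hardy_eval (hardy_shift f) z)"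
      using f(2) z by (simp add: hardy_eval_shift is_product_def bounded_operator_on_def)
  qed
  ultimately show ?thesis by (auto simp: mult_range_def)
qed

lemma brownian_shift_add: "brownian_shift \<sigma> \<theta> (u + v) = brownian_shift \<sigma> \<theta> u + brownian_shift \<sigma> \<theta> v"
  by (simp add: brownian_shift_def case_prod_beta hardy_shift_add hardy_const_add
      scaleC_add_right algebra_simps)

lemma brownian_shift_scaleC: "brownian_shift \<sigma> \<theta> (c *\<^sub>C u) = c *\<^sub>C brownian_shift \<sigma> \<theta> u"
  by (simp add: brownian_shift_def case_prod_beta scaleC_prod_def hardy_shift_scaleC hardy_const_scaleC
      scaleC_add_right scaleC_scaleC scaleC_scaleR_commute mult.commute)

lemma brownian_shift_zero_snd: "brownian_shift \<sigma> \<theta> (f, 0) = (hardy_shift f, 0)"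
  by (simp add: brownian_shift_def complex_vector.scale_zero_right
      hardy_const_0)

lemma continuous_on_brownian_shift: "continuous_on A (brownian_shift \<sigma> \<theta>)"
  unfolding brownian_shift_def case_prod_beta
  by (intro continuous_intros bounded_linear.continuous_on[OF bounded_linear_shift]
      bounded_linear.continuous_on[OF bounded_linear_const]
      bounded_linear.continuous_on[OF bounded_linear_scaleC])

lemma not_cis_in_disc: "cmod z < 1 \<Longrightarrow> z - cis \<theta> \<noteq> 0"
  by (metis eq_iff_diff_eq_0 less_irrefl norm_cis)

text \<open>The identity \<open>(z - e\<^sup>i\<^sup>\<theta>) g = h - \<sigma> y\<close> behind the definition of \<^const>\<open>G_set\<close>, read as a
  statement about the operator.\<close>
lemma brownian_shift_eigen_modulo:
  "brownian_shift \<sigma> \<theta> (g, y) = cis \<theta> *\<^sub>C (g, y) + (h, 0) \<longleftrightarrow>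
     (\<forall>z\<in>ball 0 1. hardy_eval g z = inverse (z - cis \<theta>) *\<^sub>C (hardy_eval h z - \<sigma> *\<^sub>R y))"
proof -
  have pointwise: "hardy_eval (hardy_shift g + \<sigma> *\<^sub>R hardy_const y) z = hardy_eval (cis \<theta> *\<^sub>C g + h) z
      \<longleftrightarrow> hardy_eval g z = inverse (z - cis \<theta>) *\<^sub>C (hardy_eval h z - \<sigma> *\<^sub>R y)"
    if z: "cmod z < 1" for z
  proof -
    have "hardy_eval (hardy_shift g + \<sigma> *\<^sub>R hardy_const y) z = hardy_eval (cis \<theta> *\<^sub>C g + h) z
        \<longleftrightarrow> (z - cis \<theta>) *\<^sub>C hardy_eval g z = hardy_eval h z - \<sigma> *\<^sub>R y"
      by (simp add: hardy_eval_add[OF z] hardy_eval_shift[OF z] hardy_eval_scaleR[OF z]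
          hardy_eval_scaleC[OF z] hardy_eval_const complex_vector.scale_left_diff_distrib
          algebra_simps)
    also have "\<dots> \<longleftrightarrow> hardy_eval g z = inverse (z - cis \<theta>) *\<^sub>C (hardy_eval h z - \<sigma> *\<^sub>R y)"
      using not_cis_in_disc[OF z, of \<theta>]
      by (metis (no_types, lifting) left_inverse right_inverse scaleC_one scaleC_scaleC)
    finally show ?thesis .
  qed
  have "brownian_shift \<sigma> \<theta> (g, y) = cis \<theta> *\<^sub>C (g, y) + (h, 0) \<longleftrightarrow>
      hardy_shift g + \<sigma> *\<^sub>R hardy_const y = cis \<theta> *\<^sub>C g + h"
    by (simp add: brownian_shift_def scaleC_prod_def)
  also have "\<dots> \<longleftrightarrow> (\<forall>z\<in>ball 0 1. hardy_eval (hardy_shift g + \<sigma> *\<^sub>R hardy_const y) z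
      = hardy_eval (cis \<theta> *\<^sub>C g + h) z)"
    using hardy_eval_inject[of "hardy_shift g + \<sigma> *\<^sub>R hardy_const y" "cis \<theta> *\<^sub>C g + h"] by auto
  finally show ?thesis using pointwise by simp
qed

text \<open>
  Applying \<^term>\<open>\<Phi>\<close> to the constant function \<open>x\<close> shows that \<open>\<Phi> x\<close> lies in the Hardy space, so that
  the defining property of \<open>(g, y) \<in> G\<close> becomes \<open>B (g, y) = e\<^sup>i\<^sup>\<theta> (g, y) + (\<Phi> x, 0)\<close>.
\<close>
proposition has_representation_imp_invariant:
  fixes M :: "('a::chilbert_space hardy \<times> 'a) set" and S :: "'b::chilbert_space set"
  assumes M: "csubspace M" "closed M" and rep: "has_representation \<sigma> \<theta> M S \<Phi> G"
  shows "brownian_shift \<sigma> \<theta> ` M \<subseteq> M"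
proof -
  let ?B = "brownian_shift \<sigma> \<theta>"
  have S: "hilbert_subspace S" and \<Phi>: "inner_function S \<Phi>" and GG: "G \<subseteq> G_set \<sigma> \<theta> S \<Phi>"
    and sum: "M = {a + b | a b. a \<in> closure (cspan G) \<and> b \<in> mult_range S \<Phi> \<times> {0}}"
    using rep by (auto simp: has_representation_def orthogonal_direct_sum_def)
  have \<Phi>H: "\<Phi> \<in> H_infinity S" using \<Phi> by (simp add: inner_function_def)
  have S0: "0 \<in> S" using S by (auto simp: hilbert_subspace_def complex_vector.subspace_0)
  have "0 \<in> mult_range S \<Phi>"
  proof -
    have "0 \<in> hardy_on S" using S0 by (simp add: hardy_on_def zero_hardy.rep_eq)
    then obtain h where "is_product \<Phi> 0 h" "norm h = norm (0 :: 'b hardy)"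
      using \<Phi> by (auto simp: inner_function_def)
    with \<open>0 \<in> hardy_on S\<close> show ?thesis by (auto simp: mult_range_def)
  qed
  then have closure_M: "u \<in> M" if "u \<in> closure (cspan G)" for u
    unfolding sum using that \<open>0 \<in> mult_range S \<Phi>\<close>
    by (intro CollectI exI[of _ u] exI[of _ 0]) (simp add: zero_prod_def)
  have "0 \<in> closure (cspan G)"
    using complex_vector.span_zero closure_subset by blast
  then have mult_M: "(h, 0) \<in> M" if "h \<in> mult_range S \<Phi>" for h
    unfolding sum using that \<open>0 \<in> closure (cspan G)\<close>
    by (intro CollectI exI[of _ 0] exI[of _ "(h, 0)"]) simp
  have "?B (g, y) \<in> M" if gy: "(g, y) \<in> G" for g y
  proof -
    obtain x where x: "x \<in> S"
      "\<forall>z\<in>ball 0 1. hardy_eval g z = inverse (z - cis \<theta>) *\<^sub>C (\<Phi> z x - \<sigma> *\<^sub>R y)"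
      using GG gy by (auto simp: G_set_def)
    have cx: "hardy_const x \<in> hardy_on S" using x(1) S0 by (simp add: hardy_on_def hardy_const.rep_eq)
    then obtain h where h: "is_product \<Phi> (hardy_const x) h"
      using \<Phi> by (auto simp: inner_function_def)
    then have "?B (g, y) = cis \<theta> *\<^sub>C (g, y) + (h, 0)"
      unfolding brownian_shift_eigen_modulo using x(2) by (simp add: is_product_def hardy_eval_const)
    moreover have "(g, y) \<in> M"
      using closure_M closure_subset complex_vector.span_base gy by blast
    moreover have "(h, 0) \<in> M" using mult_M cx h by (auto simp: mult_range_def)
    ultimately show ?thesis
      using M(1) by (simp add: complex_vector.subspace_add complex_vector.subspace_scale)
  qed
  then have "G \<subseteq> ?B -` M" by auto
  moreover have "csubspace (?B -` M)"
    using M(1) brownian_shift_zero_snd[of \<sigma> \<theta> "0 :: 'a hardy"]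
    by (auto simp: complex_vector.subspace_def brownian_shift_add brownian_shift_scaleC zero_prod_def
        hardy_shift_0)
  ultimately have "cspan G \<subseteq> ?B -` M" by (rule complex_vector.span_minimal)
  moreover have "closed (?B -` M)"
    by (rule closed_vimage[OF M(2) continuous_on_brownian_shift])
  ultimately have "closure (cspan G) \<subseteq> ?B -` M" by (rule closure_minimal)
  moreover have "?B b \<in> M" if "b \<in> mult_range S \<Phi> \<times> {0}" for b
    using that shift_mult_range[OF S \<Phi>H] mult_M by (auto simp: brownian_shift_zero_snd)
  ultimately have "?B (a + b) \<in> M" if "a \<in> closure (cspan G)" "b \<in> mult_range S \<Phi> \<times> {0}" for a b
    unfolding brownian_shift_add using that by (intro complex_vector.subspace_add[OF M(1)]) auto
  then show ?thesis
    by (subst (1) sum) blast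
qed

text \<open>
  Comparing coefficients in \<open>z g + \<sigma> y = e\<^sup>i\<^sup>\<theta> g\<close> shows that all coefficients of \<open>g\<close> have the same
  norm, which square-summability forces to be zero.
\<close>
lemma brownian_shift_no_eigenvector_cis:
  assumes "\<sigma> \<noteq> 0" and eq: "brownian_shift \<sigma> \<theta> (g, y) = cis \<theta> *\<^sub>C (g, y)"
  shows "g = 0 \<and> y = 0"
proof -
  have e: "hardy_shift g + \<sigma> *\<^sub>R hardy_const y = cis \<theta> *\<^sub>C g"
    using eq by (simp add: brownian_shift_def scaleC_prod_def)
  have "norm (hcoeff g (Suc n)) = norm (hcoeff g n)" for n
    using arg_cong[OF e, of "\<lambda>f. norm (hcoeff f (Suc n))"]
    by (simp add: plus_hardy.rep_eq hcoeff_shift_Suc hcoeff_scaleR hardy_const.rep_eq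
        scaleC_hardy.rep_eq norm_scaleC)
  then have const: "norm (hcoeff g n) = norm (hcoeff g 0)" for n
    by (induction n) simp_all
  have "(\<lambda>n. (norm (hcoeff g n))\<^sup>2) \<longlonglongrightarrow> 0"
    by (rule summable_LIMSEQ_zero[OF summable_hcoeff])
  also have "(\<lambda>n. (norm (hcoeff g n))\<^sup>2) = (\<lambda>_. (norm (hcoeff g 0))\<^sup>2)"
    using const by metis
  finally have "hcoeff g 0 = 0"
    by (simp add: LIMSEQ_const_iff)
  then have "hcoeff g n = 0" for n
    using const[of n] by simp
  then have g: "g = 0" by (intro hardy_eqI) (simp add: zero_hardy.rep_eq)
  then have "norm (\<sigma> *\<^sub>R hardy_const y) = 0"
    using e by (simp add: complex_vector.scale_zero_right
        hardy_shift_0)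
  with \<open>\<sigma> \<noteq> 0\<close> g show ?thesis by (simp add: norm_const)
qed

text \<open>
  For \<open>(g, y)\<close> in the complement, \<open>x = z g + \<sigma> y - e\<^sup>i\<^sup>\<theta> g\<close> lies in \<open>N\<close>, because the second component
  of \<open>(B - e\<^sup>i\<^sup>\<theta>) (g, y)\<close> is zero, and it is orthogonal to \<open>z N\<close>: the first term because \<open>g \<bottom> N\<close>, the
  second because constants are orthogonal to multiples of \<open>z\<close>, the third because \<open>g \<bottom> N\<close> and \<open>z N \<subseteq> N\<close>.
\<close>
proposition invariant_imp_has_representation:
  fixes M :: "('a::chilbert_space hardy \<times> 'a) set"
  assumes \<sigma>: "\<sigma> \<noteq> 0" and M: "csubspace M" "closed M" and not: "\<not> M \<subseteq> UNIV \<times> {0}"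
    and inv: "brownian_shift \<sigma> \<theta> ` M \<subseteq> M"
  shows "\<exists>(S :: 'a hardy set) \<Phi> G. has_representation \<sigma> \<theta> M S \<Phi> G"
proof -
  let ?B = "brownian_shift \<sigma> \<theta>" and ?\<Phi> = "\<lambda>z (a :: 'a hardy). hardy_eval a z"
  define N where "N = {f. (f, 0) \<in> M}"
  have N_add: "f + g \<in> N" if "f \<in> N" "g \<in> N" for f g
    using complex_vector.subspace_add[OF M(1), of "(f, 0)" "(g, 0)"] that by (simp add: N_def)
  have N_scale: "c *\<^sub>C f \<in> N" if "f \<in> N" for c f
    using complex_vector.subspace_scale[OF M(1), of "(f, 0)" c] that
    by (simp add: N_def scaleC_prod_def complex_vector.scale_zero_right)
  interpret shift_invariant N
  proof
    show "csubspace N"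
      using complex_vector.subspace_0[OF M(1)] N_add N_scale
      by (simp add: complex_vector.subspace_def) (simp add: N_def zero_prod_def)
    have "closed ((\<lambda>f. (f, 0)) -` M)"
      by (rule closed_vimage[OF M(2)]) (intro continuous_intros)
    then show "closed N" by (simp add: N_def vimage_def)
    show "hardy_shift f \<in> N" if "f \<in> N" for f
      using that inv brownian_shift_zero_snd[of \<sigma> \<theta> f] by (force simp: N_def)
  qed
  define G where "G = M \<ominus> (N \<times> {0})"
  have csubG: "csubspace G" and closedG: "closed G"
    unfolding G_def by (rule csubspace_ominus[OF M(1)], rule closed_ominus[OF M(2)])
  have span_G: "closure (cspan G) = G"
    using csubG closedG by (simp add: complex_vector.span_eq_iff[THEN iffD2])
  have defect: "\<exists>x\<in>wandering. ?B (g, y) = cis \<theta> *\<^sub>C (g, y) + (x, 0)" if gy: "(g, y) \<in> G" for g y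
  proof -
    define x where "x = hardy_shift g + \<sigma> *\<^sub>R hardy_const y - cis \<theta> *\<^sub>C g"
    have Bx: "?B (g, y) = cis \<theta> *\<^sub>C (g, y) + (x, 0)"
      by (simp add: brownian_shift_def scaleC_prod_def x_def)
    have gyM: "(g, y) \<in> M" and orth: "\<And>n. n \<in> N \<Longrightarrow> cinner g n = 0"
      using gy by (auto simp: G_def ominus_def cinner_prod_def
          cinner_commute[of y]
          cinner_zero_left)
    have "x \<in> N"
    proof -
      have "(x, 0) = ?B (g, y) - cis \<theta> *\<^sub>C (g, y)" by (simp add: Bx)
      also have "\<dots> \<in> M"
        using gyM inv by (intro complex_vector.subspace_diff complex_vector.subspace_scale M) auto
      finally show ?thesis by (simp add: N_def)
    qed
    moreover have "cinner x (hardy_shift n) = 0" if n: "n \<in> N" for n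
    proof -
      have "x + cis \<theta> *\<^sub>C g = hardy_shift g + complex_of_real \<sigma> *\<^sub>C hardy_const y"
        by (simp add: x_def scaleR_scaleC)
      then have "cinner x (hardy_shift n) + cis \<theta> * cinner g (hardy_shift n) =
          cinner g n + complex_of_real \<sigma> * cinner (hardy_const y) (hardy_shift n)"
        by (metis cinner_add_left cinner_scaleC_left cinner_shift_shift)
      then show ?thesis
        using orth[OF n] orth[OF shift_N[OF n]] by (simp add: cinner_const_shift)
    qed
    ultimately have "x \<in> wandering" by (rule wanderingI)
    with Bx show ?thesis by blast
  qed
  have G_subset: "G \<subseteq> G_set \<sigma> \<theta> wandering ?\<Phi>"
    using defect unfolding brownian_shift_eigen_modulo by (fastforce simp: G_set_def)
  have N0: "csubspace (N \<times> {0 :: 'a})"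
    using csubspace_N by (auto simp: complex_vector.subspace_def zero_prod_def scaleC_prod_def)
  have split: "\<exists>a\<in>G. \<exists>b\<in>N \<times> {0}. u = a + b" if "u \<in> M" for u
    unfolding G_def
    using ominus_decomposition[OF M(1) N0 closed_Times[OF closed_N closed_singleton] _ that]
    by (metis (no_types, lifting) N_def SigmaE mem_Collect_eq singletonD subsetI)
  have "\<exists>u\<in>G. snd u \<noteq> 0"
  proof -
    obtain u where u: "u \<in> M" "snd u \<noteq> 0" using not by force
    then show ?thesis using split[OF u(1)] by force
  qed
  then obtain g y where gy: "(g, y) \<in> G" "y \<noteq> 0" by auto
  have "wandering \<noteq> {0}"
  proof
    assume "wandering = {0}"
    then have "?B (g, y) = cis \<theta> *\<^sub>C (g, y)" using defect[OF gy(1)] by (simp add: zero_prod_def[symmetric])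
    with brownian_shift_no_eigenvector_cis[OF \<sigma>] gy(2) show False by blast
  qed
  moreover have "orthogonal_direct_sum M G (N \<times> {0})"
  proof -
    have "a + b \<in> M" if "a \<in> G" "b \<in> N \<times> {0}" for a b
      using that by (intro complex_vector.subspace_add[OF M(1)]) (auto simp: G_def ominus_def N_def)
    then have "M = {a + b | a b. a \<in> G \<and> b \<in> N \<times> {0}}" using split by blast
    then show ?thesis by (simp add: orthogonal_direct_sum_def G_def ominus_def)
  qed
  moreover have "\<exists>u\<in>G. u \<noteq> 0"
    using gy by (intro bexI[of _ "(g, y)"]) (simp_all add: zero_prod_def)
  ultimately have "has_representation \<sigma> \<theta> M wandering ?\<Phi> G"
    using hilbert_subspace_wandering inner_function_wandering G_subset
    by (simp add: has_representation_def span_G mult_range_wandering)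
  then show ?thesis by blast
qed

theorem theorem2p6:
  fixes M :: "('a::chilbert_space hardy \<times> 'a) set" and \<sigma> \<theta> :: real
  assumes "separable_space (euclidean :: 'a topology)"
    and "\<sigma> > 0" and "0 \<le> \<theta>" and "\<theta> < 2 * pi"
    and "csubspace M" and "closed M" and "M \<noteq> {0}"
    and "\<not> M \<subseteq> UNIV \<times> {0}"
  shows "(brownian_shift \<sigma> \<theta> ` M \<subseteq> M \<longleftrightarrow>
           (\<exists>(E2 :: 'a hardy set) \<Phi> G. has_representation \<sigma> \<theta> M E2 \<Phi> G)) \<and>
         (\<forall>(E2 :: 'b::chilbert_space set) \<Phi> G.
           has_representation \<sigma> \<theta> M E2 \<Phi> G \<longrightarrow> brownian_shift \<sigma> \<theta> ` M \<subseteq> M)"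
proof (intro conjI iffI allI impI)
  assume "brownian_shift \<sigma> \<theta> ` M \<subseteq> M"
  with assms show "\<exists>(E2 :: 'a hardy set) \<Phi> G. has_representation \<sigma> \<theta> M E2 \<Phi> G"
    by (intro invariant_imp_has_representation) simp_all
next
  assume "\<exists>(E2 :: 'a hardy set) \<Phi> G. has_representation \<sigma> \<theta> M E2 \<Phi> G"
  with assms show "brownian_shift \<sigma> \<theta> ` M \<subseteq> M"
    by (elim exE) (rule has_representation_imp_invariant)
next
  fix E2 :: "'b set" and \<Phi> G
  assume "has_representation \<sigma> \<theta> M E2 \<Phi> G"
  with assms show "brownian_shift \<sigma> \<theta> ` M \<subseteq> M"
    by (intro has_representation_imp_invariant)
qed

end
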